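(* Let $\Sigma^n$ be a free boundary minimal hypersurface in the unit ball $\mathbb{B}^{n+1}$. If $|A|^2\le 2n$ on $\Sigma$, then $\Sigma$ is a totally geodesic equatorial disk $\mathbb{D}^n$.
   Context: $\mathbb{B}^{n+1}\subset\mathbb{R}^{n+1}$ is the unit ball centered at the origin. $\Sigma$ is a compact, connected, oriented, smooth immersed hypersurface of $\mathbb{R}^{n+1}$ contained in $\mathbb{B}^{n+1}$, with $\partial\Sigma\subset\partial\mathbb{B}^{n+1}$; free boundary means that $\Sigma$ meets $\partial\mathbb{B}^{n+1}$ orthogonally along $\partial\Sigma$. $|A|^2$ is the squared norm of the second fundamental form of $\Sigma$. An equatorial disk $\mathbb{D}^n$ is the intersection of $\mathbb{B}^{n+1}$ with a hyperplane through the origin. *)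

theory Defs
  imports "HOL-Analysis.Analysis"
begin

section \<open>Smooth maps\<close>

text \<open>Only meant for open \<open>U\<close>.\<close>

primrec Ck_on :: "nat \<Rightarrow> 'a::euclidean_space set \<Rightarrow> ('a \<Rightarrow> 'b::real_normed_vector) \<Rightarrow> bool" where
  "Ck_on 0 U f \<longleftrightarrow> continuous_on U f"
| "Ck_on (Suc k) U f \<longleftrightarrow>
     (\<forall>x\<in>U. f differentiable (at x)) \<and>
     (\<forall>v. Ck_on k U (\<lambda>x. frechet_derivative f (at x) v))"

text \<open>On an arbitrary set (in particular a relatively open subset of a half-space), smooth means
  locally extendable to a smooth function on an open set.\<close>

definition smooth_on :: "'a::euclidean_space set \<Rightarrow> ('a \<Rightarrow> 'b::real_normed_vector) \<Rightarrow> bool" where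
  "smooth_on S f \<longleftrightarrow>
     (\<forall>x\<in>S. \<exists>U g. open U \<and> x \<in> U \<and> (\<forall>k. Ck_on k U g) \<and> (\<forall>y\<in>S \<inter> U. g y = f y))"


section \<open>Compact smooth manifolds with boundary\<close>

text \<open>The type \<open>'d\<close> is the model space; its dimension is the dimension of the manifold. Which basis
  vector bounds the half-space is immaterial.\<close>

definition inward_dir :: "'d::euclidean_space" where
  "inward_dir = (SOME b. b \<in> Basis)"

definition half_space :: "'d::euclidean_space set" where
  "half_space = {x. 0 \<le> x \<bullet> inward_dir}"

type_synonym ('m, 'd) chart = "'m set \<times> ('m \<Rightarrow> 'd)"

definition chart_image :: "('m, 'd) chart \<Rightarrow> 'd set" where
  "chart_image c = snd c ` fst c"

definition chart_inv :: "('m, 'd) chart \<Rightarrow> 'd \<Rightarrow> 'm" where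
  "chart_inv c = inv_into (fst c) (snd c)"

definition is_chart :: "'m::topological_space set \<Rightarrow> ('m, 'd::euclidean_space) chart \<Rightarrow> bool" where
  "is_chart M c \<longleftrightarrow>
     openin (top_of_set M) (fst c) \<and>
     openin (top_of_set half_space) (chart_image c) \<and>
     homeomorphism (fst c) (chart_image c) (snd c) (chart_inv c)"

definition smooth_atlas ::
  "'m::topological_space set \<Rightarrow> ('m, 'd::euclidean_space) chart set \<Rightarrow> bool" where
  "smooth_atlas M \<A> \<longleftrightarrow>
     (\<forall>c\<in>\<A>. is_chart M c) \<and>
     M = (\<Union>c\<in>\<A>. fst c) \<and>
     (\<forall>c\<in>\<A>. \<forall>c'\<in>\<A>. smooth_on (snd c ` (fst c \<inter> fst c')) (snd c' \<circ> chart_inv c))"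

text \<open>Second countability is not listed: it follows from compactness and the existence of charts.\<close>

definition compact_connected_manifold ::
  "'m::t2_space set \<Rightarrow> ('m, 'd::euclidean_space) chart set \<Rightarrow> bool" where
  "compact_connected_manifold M \<A> \<longleftrightarrow>
     M \<noteq> {} \<and> compact M \<and> connected M \<and> smooth_atlas M \<A>"

definition manifold_boundary :: "('m, 'd::euclidean_space) chart set \<Rightarrow> 'm set" where
  "manifold_boundary \<A> = {p. \<exists>c\<in>\<A>. p \<in> fst c \<and> snd c p \<bullet> inward_dir = 0}"


section \<open>Oriented immersed hypersurfaces\<close>

definition in_chart :: "('m, 'd) chart \<Rightarrow> ('m \<Rightarrow> 'e) \<Rightarrow> 'd \<Rightarrow> 'e" where
  "in_chart c F = F \<circ> chart_inv c"

definition smooth_map ::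
  "('m, 'd::euclidean_space) chart set \<Rightarrow> ('m \<Rightarrow> 'e::real_normed_vector) \<Rightarrow> bool" where
  "smooth_map \<A> F \<longleftrightarrow> (\<forall>c\<in>\<A>. smooth_on (chart_image c) (in_chart c F))"

text \<open>Derivatives are taken within the image of the chart, so that boundary points are covered; they
  are unique there, since the image is relatively open in a half-space.\<close>

definition chart_deriv ::
  "('m, 'd::euclidean_space) chart \<Rightarrow> ('m \<Rightarrow> 'e::real_normed_vector) \<Rightarrow> 'm \<Rightarrow> 'd \<Rightarrow> 'e" where
  "chart_deriv c F p v = frechet_derivative (in_chart c F) (at (snd c p) within chart_image c) v"

definition chart_deriv2 ::
  "('m, 'd::euclidean_space) chart \<Rightarrow> ('m \<Rightarrow> 'e::real_normed_vector) \<Rightarrow> 'm \<Rightarrow> 'd \<Rightarrow> 'd \<Rightarrow> 'e" where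
  "chart_deriv2 c F p u v = chart_deriv c (\<lambda>q. chart_deriv c F q v) p u"

definition immersion ::
  "('m, 'd::euclidean_space) chart set \<Rightarrow> ('m \<Rightarrow> 'e::real_normed_vector) \<Rightarrow> bool" where
  "immersion \<A> F \<longleftrightarrow>
     smooth_map \<A> F \<and> (\<forall>c\<in>\<A>. \<forall>p\<in>fst c. inj (chart_deriv c F p))"

text \<open>As usual for hypersurfaces, an orientation is a choice of a global smooth unit normal field.\<close>

definition unit_normal_field ::
  "('m, 'd::euclidean_space) chart set \<Rightarrow> ('m \<Rightarrow> 'e::euclidean_space) \<Rightarrow> ('m \<Rightarrow> 'e) \<Rightarrow> bool" where
  "unit_normal_field \<A> F N \<longleftrightarrow>
     smooth_map \<A> N \<and>
     (\<forall>c\<in>\<A>. \<forall>p\<in>fst c. norm (N p) = 1 \<and> (\<forall>v. N p \<bullet> chart_deriv c F p v = 0))"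

definition oriented_immersed_hypersurface ::
  "'m::t2_space set \<Rightarrow> ('m, 'd::euclidean_space) chart set \<Rightarrow>
   ('m \<Rightarrow> 'e::euclidean_space) \<Rightarrow> ('m \<Rightarrow> 'e) \<Rightarrow> bool" where
  "oriented_immersed_hypersurface M \<A> F N \<longleftrightarrow>
     DIM('e) = DIM('d) + 1 \<and>
     compact_connected_manifold M \<A> \<and> immersion \<A> F \<and> unit_normal_field \<A> F N"


section \<open>Second fundamental form\<close>

text \<open>Tangent vectors at \<open>p\<close> are represented by their components in the chart \<open>c\<close>. The scalars
  below do not depend on the chart around \<open>p\<close> nor on the orthonormal frame.\<close>

definition first_fundamental_form ::
  "('m, 'd::euclidean_space) chart \<Rightarrow> ('m \<Rightarrow> 'e::euclidean_space) \<Rightarrow> 'm \<Rightarrow> 'd \<Rightarrow> 'd \<Rightarrow> real" where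
  "first_fundamental_form c F p u v = chart_deriv c F p u \<bullet> chart_deriv c F p v"

definition second_fundamental_form ::
  "('m, 'd::euclidean_space) chart \<Rightarrow> ('m \<Rightarrow> 'e::euclidean_space) \<Rightarrow> ('m \<Rightarrow> 'e) \<Rightarrow>
   'm \<Rightarrow> 'd \<Rightarrow> 'd \<Rightarrow> real" where
  "second_fundamental_form c F N p u v = chart_deriv2 c F p u v \<bullet> N p"

definition is_orthonormal_frame ::
  "('m, 'd::euclidean_space) chart \<Rightarrow> ('m \<Rightarrow> 'e::euclidean_space) \<Rightarrow> 'm \<Rightarrow> 'd set \<Rightarrow> bool" where
  "is_orthonormal_frame c F p B \<longleftrightarrow>
     finite B \<and> span B = UNIV \<and>
     (\<forall>u\<in>B. \<forall>v\<in>B. first_fundamental_form c F p u v = (if u = v then 1 else 0))"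

definition orthonormal_frame ::
  "('m, 'd::euclidean_space) chart \<Rightarrow> ('m \<Rightarrow> 'e::euclidean_space) \<Rightarrow> 'm \<Rightarrow> 'd set" where
  "orthonormal_frame c F p = (SOME B. is_orthonormal_frame c F p B)"

definition mean_curvature ::
  "('m, 'd::euclidean_space) chart \<Rightarrow> ('m \<Rightarrow> 'e::euclidean_space) \<Rightarrow> ('m \<Rightarrow> 'e) \<Rightarrow> 'm \<Rightarrow> real" where
  "mean_curvature c F N p =
     (\<Sum>u\<in>orthonormal_frame c F p. second_fundamental_form c F N p u u)"

definition norm_A_squared ::
  "('m, 'd::euclidean_space) chart \<Rightarrow> ('m \<Rightarrow> 'e::euclidean_space) \<Rightarrow> ('m \<Rightarrow> 'e) \<Rightarrow> 'm \<Rightarrow> real" where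
  "norm_A_squared c F N p =
     (\<Sum>u\<in>orthonormal_frame c F p. \<Sum>v\<in>orthonormal_frame c F p.
        (second_fundamental_form c F N p u v)\<^sup>2)"

definition minimal ::
  "('m, 'd::euclidean_space) chart set \<Rightarrow> ('m \<Rightarrow> 'e::euclidean_space) \<Rightarrow> ('m \<Rightarrow> 'e) \<Rightarrow> bool" where
  "minimal \<A> F N \<longleftrightarrow> (\<forall>c\<in>\<A>. \<forall>p\<in>fst c. mean_curvature c F N p = 0)"

definition totally_geodesic ::
  "('m, 'd::euclidean_space) chart set \<Rightarrow> ('m \<Rightarrow> 'e::euclidean_space) \<Rightarrow> ('m \<Rightarrow> 'e) \<Rightarrow> bool" where
  "totally_geodesic \<A> F N \<longleftrightarrow>
     (\<forall>c\<in>\<A>. \<forall>p\<in>fst c. \<forall>u v. second_fundamental_form c F N p u v = 0)"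


section \<open>Free boundary hypersurfaces of the unit ball\<close>

text \<open>Along the boundary the hypersurface meets the sphere at the angle between their unit normals
  \<open>N p\<close> and \<open>F p\<close>.\<close>

definition free_boundary_in_unit_ball ::
  "'m set \<Rightarrow> ('m, 'd::euclidean_space) chart set \<Rightarrow>
   ('m \<Rightarrow> 'e::euclidean_space) \<Rightarrow> ('m \<Rightarrow> 'e) \<Rightarrow> bool" where
  "free_boundary_in_unit_ball M \<A> F N \<longleftrightarrow>
     F ` M \<subseteq> cball 0 1 \<and>
     (\<forall>p\<in>manifold_boundary \<A>. F p \<in> sphere 0 1 \<and> orthogonal (N p) (F p))"

definition equatorial_disk :: "'e::euclidean_space set \<Rightarrow> bool" where
  "equatorial_disk D \<longleftrightarrow> (\<exists>a. a \<noteq> 0 \<and> D = cball 0 1 \<inter> {x. a \<bullet> x = 0})"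

end

theory Submission
  imports Defs
begin

text \<open>The support function \<open>u = \<langle>F, N\<rangle>\<close> satisfies \<open>\<Delta>u + |A|\<^sup>2 u = 0\<close> and vanishes on the
  boundary because of the free boundary condition. The pinching yields a positive function \<open>\<phi>\<close> of
  \<open>|F|\<^sup>2\<close> with \<open>\<Delta>\<phi> + |A|\<^sup>2 \<phi> < 0\<close>, so \<open>u / \<phi>\<close> has neither a positive interior maximum nor a
  negative interior minimum, and \<open>u = 0\<close>. Hence the hypersurface is a cone, smooth at its vertex, and
  \<open>N\<close> takes only the values attained at the finitely many zeros of \<open>F\<close>; by connectedness \<open>N\<close> is
  constant. Then \<open>F\<close> is a local homeomorphism into the equatorial disk orthogonal to \<open>N\<close>, and by
  compactness and convexity of the disk it is bijective.\<close>

section \<open>Twice differentiable maps\<close>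

text \<open>The argument works at single points of a chart, without a connection or a
  Laplace-Beltrami operator: at a critical point, the sum of the chart second derivatives over an
  orthonormal frame is the Laplacian, since the Christoffel correction is a first derivative. Two
  obstacles shape the rest. Chart images are only relatively open in a half-space, so
  \<open>F\<close> and \<open>N\<close> are extended to open sets across the boundary; the
  extensions satisfy the geometric identities only on the half-space, yet this suffices to
  differentiate the identities at boundary points. Moreover, minimality and the pinching are known
  in a frame chosen separately at each point, so the mean curvature cannot be differentiated through
  its frame; the traced Codazzi equation comes instead from a quadratic error estimate for one fixed
  frame. The bound 2n is what comparison with 1 - |F|^2 tolerates: on a minimal hypersurface the
  Laplacian of that function is -2n, and adding 2n (1 - |F|^2) leaves -2n |F|^2.\<close>

definition C2_jet ::
  "'a::euclidean_space set \<Rightarrow> ('a \<Rightarrow> 'b::euclidean_space) \<Rightarrow> ('a \<Rightarrow> 'a \<Rightarrow> 'b) \<Rightarrow> ('a \<Rightarrow> 'a \<Rightarrow> 'a \<Rightarrow> 'b) \<Rightarrow> bool"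
  where "C2_jet U f Df D2f \<longleftrightarrow>
    open U \<and> (\<forall>z\<in>U. (f has_derivative Df z) (at z)) \<and>
    (\<forall>z\<in>U. \<forall>v. ((\<lambda>y. Df y v) has_derivative (\<lambda>u. D2f z u v)) (at z)) \<and>
    (\<forall>u v. continuous_on U (\<lambda>z. D2f z u v))"

lemma C2_jetD:
  assumes "C2_jet U f Df D2f"
  shows "open U"
    and "z \<in> U \<Longrightarrow> (f has_derivative Df z) (at z)"
    and "z \<in> U \<Longrightarrow> ((\<lambda>y. Df y v) has_derivative (\<lambda>u. D2f z u v)) (at z)"
    and "continuous_on U (\<lambda>z. D2f z u v)"
  using assms by (auto simp: C2_jet_def)

lemma C2_jet_subset:
  "C2_jet U f Df D2f \<Longrightarrow> open V \<Longrightarrow> V \<subseteq> U \<Longrightarrow> C2_jet V f Df D2f"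
  unfolding C2_jet_def by (meson continuous_on_subset subsetD)

lemma Ck_on_imp_C2_jet:
  fixes f :: "'a::euclidean_space \<Rightarrow> 'b::euclidean_space"
  assumes "open U" "Ck_on 2 U f"
  shows "C2_jet U f (\<lambda>z. frechet_derivative f (at z))
    (\<lambda>z u v. frechet_derivative (\<lambda>y. frechet_derivative f (at y) v) (at z) u)"
  using assms by (auto simp: C2_jet_def numeral_2_eq_2 frechet_derivative_works[symmetric])

lemma has_real_derivative_along_line:
  fixes h :: "'a::real_normed_vector \<Rightarrow> real"
  assumes h: "(h has_derivative h') (at (x + t *\<^sub>R v))"
  shows "((\<lambda>t. h (x + t *\<^sub>R v)) has_real_derivative h' v) (at t)"
proof -
  have "((\<lambda>t. h (x + t *\<^sub>R v)) has_derivative (\<lambda>s. h' (s *\<^sub>R v))) (at t)"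
    by (rule has_derivative_compose[where g=h and g'=h' and f="\<lambda>t. x + t *\<^sub>R v"])
       (auto intro!: derivative_eq_intros simp: h)
  then show ?thesis
    by (simp add: has_field_derivative_def linear_cmul[OF has_derivative_linear[OF h]] mult.commute[of _ "h' v"])
qed

text \<open>Two mean value theorems: one along \<open>u\<close> for the difference of
  \<open>f\<close> in direction \<open>v\<close>, then one along \<open>v\<close> for
  \<open>Df\<close> applied to \<open>u\<close>. The left side is symmetric in \<open>u\<close> and
  \<open>v\<close>, the right side is not visibly so.\<close>

lemma second_difference:
  fixes f :: "'a::real_normed_vector \<Rightarrow> real"
  assumes df: "\<And>y. y \<in> U \<Longrightarrow> (f has_derivative Df y) (at y)"
    and d2f: "\<And>y. y \<in> U \<Longrightarrow> ((\<lambda>y. Df y u) has_derivative (\<lambda>v. D2f y v u)) (at y)"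
    and t: "0 < t"
    and sub: "\<And>a b. 0 \<le> a \<Longrightarrow> a \<le> t \<Longrightarrow> 0 \<le> b \<Longrightarrow> b \<le> t \<Longrightarrow> x + a *\<^sub>R u + b *\<^sub>R v \<in> U"
  shows "\<exists>a b. 0 < a \<and> a < t \<and> 0 < b \<and> b < t \<and>
    f (x + t *\<^sub>R u + t *\<^sub>R v) - f (x + t *\<^sub>R u) - f (x + t *\<^sub>R v) + f x =
      t * t * D2f (x + a *\<^sub>R u + b *\<^sub>R v) v u"
proof -
  define g where "g a = f (x + a *\<^sub>R u + t *\<^sub>R v) - f (x + a *\<^sub>R u + 0 *\<^sub>R v)" for a
  have dline: "((\<lambda>a. f (x + a *\<^sub>R u + b *\<^sub>R v)) has_real_derivative Df (x + a *\<^sub>R u + b *\<^sub>R v) u) (at a)"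
    if "0 \<le> a" "a \<le> t" "0 \<le> b" "b \<le> t" for a b
  proof -
    have d: "(f has_derivative Df (x + a *\<^sub>R u + b *\<^sub>R v)) (at (x + a *\<^sub>R u + b *\<^sub>R v))"
      using df sub that by blast
    show ?thesis
      using has_real_derivative_along_line[of f _ "x + b *\<^sub>R v" a u] d by (simp add: add_ac)
  qed
  have "\<exists>a. 0 < a \<and> a < t \<and> g t - g 0 =
      (t - 0) * (Df (x + a *\<^sub>R u + t *\<^sub>R v) u - Df (x + a *\<^sub>R u + 0 *\<^sub>R v) u)"
    by (rule MVT2[OF t]) (unfold g_def, intro DERIV_diff dline, use t in auto)
  then obtain a where a: "0 < a" "a < t"
    and ga: "g t - g 0 = t * (Df (x + a *\<^sub>R u + t *\<^sub>R v) u - Df (x + a *\<^sub>R u + 0 *\<^sub>R v) u)" by auto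
  have "\<exists>b. 0 < b \<and> b < t \<and> Df (x + a *\<^sub>R u + t *\<^sub>R v) u - Df (x + a *\<^sub>R u + 0 *\<^sub>R v) u =
      (t - 0) * D2f (x + a *\<^sub>R u + b *\<^sub>R v) v u"
  proof (rule MVT2[OF t])
    fix b assume b: "0 \<le> b" "b \<le> t"
    have d: "((\<lambda>y. Df y u) has_derivative (\<lambda>v'. D2f (x + a *\<^sub>R u + b *\<^sub>R v) v' u)) (at (x + a *\<^sub>R u + b *\<^sub>R v))"
      using d2f sub b a by simp
    then show "((\<lambda>b. Df (x + a *\<^sub>R u + b *\<^sub>R v) u) has_real_derivative D2f (x + a *\<^sub>R u + b *\<^sub>R v) v u) (at b)"
      by (rule has_real_derivative_along_line[where h="\<lambda>y. Df y u"])
  qed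
  then obtain b where "0 < b" "b < t"
    "Df (x + a *\<^sub>R u + t *\<^sub>R v) u - Df (x + a *\<^sub>R u + 0 *\<^sub>R v) u = t * D2f (x + a *\<^sub>R u + b *\<^sub>R v) v u"
    by auto
  then show ?thesis
    using a ga by (intro exI[of _ a] exI[of _ b]) (simp add: g_def)
qed

text \<open>The same second difference equals t^2 times \<open>D2f\<close> in either order, at two
  points of a small parallelogram; by continuity both values are close to those at
  \<open>z\<close>.\<close>

lemma symmetric_second_derivative_real:
  fixes f :: "'a::euclidean_space \<Rightarrow> real"
  assumes C2: "C2_jet U f Df D2f" and z: "z \<in> U"
  shows "D2f z u v = D2f z v u"
proof (rule ccontr)
  define e where "e = \<bar>D2f z u v - D2f z v u\<bar> / 2"
  assume "\<not> ?thesis"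
  then have e: "e > 0" by (simp add: e_def)
  have cont: "isCont (\<lambda>z. D2f z u v) z" "isCont (\<lambda>z. D2f z v u) z"
    using C2_jetD[OF C2] z continuous_on_eq_continuous_at by blast+
  obtain d1 where d1: "d1 > 0" "\<And>y. dist y z < d1 \<Longrightarrow> dist (D2f y u v) (D2f z u v) < e"
    using cont(1) e unfolding continuous_at_eps_delta by metis
  obtain d2 where d2: "d2 > 0" "\<And>y. dist y z < d2 \<Longrightarrow> dist (D2f y v u) (D2f z v u) < e"
    using cont(2) e unfolding continuous_at_eps_delta by metis
  obtain d3 where d3: "d3 > 0" "ball z d3 \<subseteq> U"
    using C2_jetD(1)[OF C2] z open_contains_ball by blast
  define d where "d = min d1 (min d2 d3)"
  \<comment> \<open>Small enough for the whole parallelogram to lie within distance d/2 of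
    \<open>z\<close>; the summand 1 covers u = v = 0.\<close>
  define t where "t = d / (2 * (norm u + norm v + 1))"
  have d: "d > 0" using d1 d2 d3 by (simp add: d_def)
  have nn: "norm u + norm v + 1 > 0"
    by (simp add: add_nonneg_pos)
  have t: "t > 0" unfolding t_def using d nn by simp
  have near: "dist (z + a *\<^sub>R u + b *\<^sub>R v) z < d" if "0 \<le> a" "a \<le> t" "0 \<le> b" "b \<le> t" for a b
  proof -
    have "dist (z + a *\<^sub>R u + b *\<^sub>R v) z \<le> a * norm u + b * norm v"
      using norm_triangle_ineq[of "a *\<^sub>R u" "b *\<^sub>R v"] that by (simp add: dist_norm add.assoc)
    also have "\<dots> \<le> t * norm u + t * norm v"
      using that by (intro add_mono mult_right_mono) auto
    also have "\<dots> \<le> t * (norm u + norm v + 1)"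
      using t by (simp add: algebra_simps)
    also have "\<dots> = d / 2"
      unfolding t_def using nn by (simp add: field_simps)
    finally show ?thesis using d by simp
  qed
  have inU: "z + a *\<^sub>R u + b *\<^sub>R v \<in> U" if "0 \<le> a" "a \<le> t" "0 \<le> b" "b \<le> t" for a b
    using near[OF that] d3 by (auto simp: d_def dist_commute)
  have inU': "z + a *\<^sub>R v + b *\<^sub>R u \<in> U" if "0 \<le> a" "a \<le> t" "0 \<le> b" "b \<le> t" for a b
    using inU[of b a] that by (simp add: algebra_simps)
  obtain a b where ab: "0 < a" "a < t" "0 < b" "b < t" and
    eq1: "f (z + t *\<^sub>R u + t *\<^sub>R v) - f (z + t *\<^sub>R u) - f (z + t *\<^sub>R v) + f z =
      t * t * D2f (z + a *\<^sub>R u + b *\<^sub>R v) v u"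
    using second_difference[of U f Df u D2f t z v, OF C2_jetD(2)[OF C2] C2_jetD(3)[OF C2] t inU] by blast
  obtain a' b' where ab': "0 < a'" "a' < t" "0 < b'" "b' < t" and
    eq2: "f (z + t *\<^sub>R v + t *\<^sub>R u) - f (z + t *\<^sub>R v) - f (z + t *\<^sub>R u) + f z =
      t * t * D2f (z + a' *\<^sub>R v + b' *\<^sub>R u) u v"
    using second_difference[of U f Df v D2f t z u, OF C2_jetD(2)[OF C2] C2_jetD(3)[OF C2] t inU'] by blast
  have "t * t * D2f (z + a *\<^sub>R u + b *\<^sub>R v) v u = t * t * D2f (z + b' *\<^sub>R u + a' *\<^sub>R v) u v"
    using eq1 eq2 by (simp add: algebra_simps)
  then have "D2f (z + a *\<^sub>R u + b *\<^sub>R v) v u = D2f (z + b' *\<^sub>R u + a' *\<^sub>R v) u v"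
    using t by simp
  moreover have "\<bar>D2f (z + a *\<^sub>R u + b *\<^sub>R v) v u - D2f z v u\<bar> < e"
    using d2(2)[of "z + a *\<^sub>R u + b *\<^sub>R v"] near[of a b] ab by (simp add: dist_real_def d_def)
  moreover have "\<bar>D2f (z + b' *\<^sub>R u + a' *\<^sub>R v) u v - D2f z u v\<bar> < e"
    using d1(2)[of "z + b' *\<^sub>R u + a' *\<^sub>R v"] near[of b' a'] ab' by (simp add: dist_real_def d_def)
  ultimately show False
    unfolding e_def by (smt (verit) field_sum_of_halves)
qed

lemma symmetric_second_derivative:
  fixes f :: "'a::euclidean_space \<Rightarrow> 'b::euclidean_space"
  assumes C2: "C2_jet U f Df D2f" and z: "z \<in> U"
  shows "D2f z u v = D2f z v u"
proof -
  have "D2f z u v \<bullet> w = D2f z v u \<bullet> w" for w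
  proof (rule symmetric_second_derivative_real[of U "\<lambda>y. f y \<bullet> w" "\<lambda>y v. Df y v \<bullet> w" "\<lambda>y u v. D2f y u v \<bullet> w", OF _ z])
    show "C2_jet U (\<lambda>y. f y \<bullet> w) (\<lambda>y v. Df y v \<bullet> w) (\<lambda>y u v. D2f y u v \<bullet> w)"
      using C2 unfolding C2_jet_def
      by (auto intro!: has_derivative_inner_left continuous_intros)
  qed
  then show ?thesis by (blast intro: euclidean_eqI)
qed

text \<open>The derivative property gives linearity of \<open>D2f z u v\<close> in \<open>u\<close>
  only; linearity in \<open>v\<close> is a consequence of symmetry.\<close>

lemma C2_jet_linear:
  assumes C2: "C2_jet U f Df D2f" and z: "z \<in> U"
  shows "linear (Df z)" "linear (\<lambda>u. D2f z u v)" "linear (D2f z u)"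
proof -
  show "linear (Df z)" "linear (\<lambda>u. D2f z u v)"
    using C2_jetD(2,3)[OF C2 z] has_derivative_linear by blast+
  have "D2f z u = (\<lambda>v. D2f z v u)"
    using symmetric_second_derivative[OF C2 z] by auto
  then show "linear (D2f z u)"
    using has_derivative_linear[OF C2_jetD(3)[OF C2 z]] by simp
qed

section \<open>Minima on a half-space\<close>

text \<open>First-order condition for a constrained minimum: the condition on \<open>v\<close> says
  that a short ray from \<open>z\<close> in direction \<open>v\<close> stays in the half-space, and
  a negative derivative would decrease \<open>h\<close> along it.\<close>

lemma inward_min_deriv_nonneg:
  fixes h :: "'d::euclidean_space \<Rightarrow> real"
  assumes h: "(h has_derivative h') (at z)" and U: "open U" "z \<in> U" and z: "z \<in> half_space"
    and min: "\<And>y. y \<in> U \<inter> half_space \<Longrightarrow> h z \<le> h y"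
    and v: "0 < z \<bullet> inward_dir \<or> 0 \<le> v \<bullet> inward_dir"
  shows "0 \<le> h' v"
proof (rule ccontr)
  assume neg: "\<not> 0 \<le> h' v"
  have "((\<lambda>t. h (z + t *\<^sub>R v)) has_real_derivative h' v) (at 0)"
    by (rule has_real_derivative_along_line) (simp add: h)
  then obtain d where d: "d > 0" "\<And>t. 0 < t \<Longrightarrow> t < d \<Longrightarrow> h (z + t *\<^sub>R v) < h z"
    using DERIV_neg_dec_right[of "\<lambda>t. h (z + t *\<^sub>R v)" "h' v" 0] neg by auto
  have "((\<lambda>t. z + t *\<^sub>R v) \<longlongrightarrow> z + 0 *\<^sub>R v) (at_right 0)"
    by (intro tendsto_intros)
  then have "eventually (\<lambda>t. z + t *\<^sub>R v \<in> U) (at_right 0)"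
    using U by (auto dest!: topological_tendstoD)
  moreover have "eventually (\<lambda>t. z + t *\<^sub>R v \<in> half_space) (at_right (0::real))"
  proof (cases "0 \<le> v \<bullet> inward_dir")
    case True
    then show ?thesis
      using z eventually_at_right_less[of "0::real"]
      by (auto simp: half_space_def inner_add_left elim!: eventually_mono)
  next
    case False
    have "((\<lambda>t. (z + t *\<^sub>R v) \<bullet> inward_dir) \<longlongrightarrow> (z + 0 *\<^sub>R v) \<bullet> inward_dir) (at_right (0::real))"
      by (intro tendsto_intros)
    then have "eventually (\<lambda>t. 0 < (z + t *\<^sub>R v) \<bullet> inward_dir) (at_right (0::real))"
      using v False order_tendstoD(1) by fastforce
    then show ?thesis by eventually_elim (simp add: half_space_def)
  qed
  moreover have "eventually (\<lambda>t. t \<in> {0<..<d}) (at_right (0::real))"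
    using d(1) eventually_at_right_real by blast
  ultimately have "eventually (\<lambda>t::real. False) (at_right 0)"
  proof eventually_elim
    case (elim t)
    then show ?case using d(2)[of t] min[of "z + t *\<^sub>R v"] by auto
  qed
  then show False by simp
qed

text \<open>This allows identities that hold only on the half-space to be differentiated at boundary
  points. For weakly inward \<open>v\<close> every function \<open>w \<bullet> h\<close> is minimal
  at \<open>z\<close>; taking \<open>w = - h' v\<close> forces \<open>h' v = 0\<close>. Outward
  directions follow by linearity.\<close>

lemma half_space_deriv_zero:
  fixes h :: "'d::euclidean_space \<Rightarrow> 'b::euclidean_space"
  assumes h: "(h has_derivative h') (at z)" and U: "open U" "z \<in> U" and z: "z \<in> half_space"
    and const: "\<And>y. y \<in> U \<inter> half_space \<Longrightarrow> h y = h z"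
  shows "h' v = 0"
proof -
  have *: "h' v = 0" if v: "0 \<le> v \<bullet> inward_dir" for v
  proof -
    have "0 \<le> w \<bullet> h' v" for w
    proof (rule inward_min_deriv_nonneg[where h="\<lambda>y. w \<bullet> h y" and h'="\<lambda>v. w \<bullet> h' v", OF _ U z])
      show "((\<lambda>y. w \<bullet> h y) has_derivative (\<lambda>v. w \<bullet> h' v)) (at z)"
        using h by (rule has_derivative_inner_right)
    qed (use const v in auto)
    from this[of "- h' v"] show ?thesis
      by (metis inner_ge_zero inner_eq_zero_iff inner_minus_left neg_0_le_iff_le order_antisym)
  qed
  show ?thesis
  proof (cases "0 \<le> v \<bullet> inward_dir")
    case False
    then have "h' (- v) = 0" by (intro *) auto
    then show ?thesis using linear_neg[OF has_derivative_linear[OF h], of v] by simp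
  qed (rule *)
qed

lemma interior_min_deriv_zero:
  fixes h :: "'d::euclidean_space \<Rightarrow> real"
  assumes h: "(h has_derivative h') (at z)" and U: "open U" "z \<in> U" and z: "0 < z \<bullet> inward_dir"
    and min: "\<And>y. y \<in> U \<inter> half_space \<Longrightarrow> h z \<le> h y"
  shows "h' v = 0"
proof -
  have "z \<in> half_space" using z by (simp add: half_space_def)
  then have "0 \<le> h' v" for v
    using inward_min_deriv_nonneg[OF h U _ min] z by blast
  from this[of v] this[of "- v"] show ?thesis
    using linear_neg[OF has_derivative_linear[OF h], of v] by simp
qed

text \<open>If \<open>h2 v\<close> were negative, the derivative along the line, which is 0 at the
  minimum, would be negative just after it, and the mean value theorem would give a smaller value of
  \<open>h\<close>.\<close>

lemma interior_min_deriv2_nonneg: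
  fixes h :: "'d::euclidean_space \<Rightarrow> real"
  assumes h: "\<And>y. y \<in> U \<Longrightarrow> (h has_derivative h' y) (at y)"
    and h2: "((\<lambda>y. h' y v) has_derivative h2) (at z)"
    and U: "open U" "z \<in> U" and z: "0 < z \<bullet> inward_dir"
    and min: "\<And>y. y \<in> U \<inter> half_space \<Longrightarrow> h z \<le> h y"
  shows "0 \<le> h2 v"
proof (rule ccontr)
  assume neg: "\<not> 0 \<le> h2 v"
  have "((\<lambda>t. h' (z + t *\<^sub>R v) v) has_real_derivative h2 v) (at 0)"
    by (rule has_real_derivative_along_line[where h="\<lambda>y. h' y v"]) (simp add: h2)
  then obtain d where d: "d > 0" "\<And>t. 0 < t \<Longrightarrow> t < d \<Longrightarrow> h' (z + t *\<^sub>R v) v < h' z v"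
    using DERIV_neg_dec_right[of "\<lambda>t. h' (z + t *\<^sub>R v) v" "h2 v" 0] neg by auto
  have z0: "h' z v = 0"
    by (rule interior_min_deriv_zero[OF h[OF U(2)] U z min])
  have "open (U \<inter> {y. 0 < y \<bullet> inward_dir})"
    using U by (intro open_Int open_halfspace_component_gt) (auto intro!: open_Collect_less continuous_intros)
  then obtain e where e: "e > 0" "ball z e \<subseteq> U \<inter> {y. 0 < y \<bullet> inward_dir}"
    using U z open_contains_ball by (metis IntI mem_Collect_eq)
  define t where "t = min (d / 2) (e / (2 * (norm v + 1)))"
  have nv: "norm v + 1 > 0" by (simp add: add_nonneg_pos)
  have t: "0 < t" "t < d" using d(1) e(1) nv by (auto simp: t_def)
  have inU: "z + s *\<^sub>R v \<in> U \<inter> half_space" if "0 \<le> s" "s \<le> t" for s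
  proof -
    have "norm (s *\<^sub>R v) \<le> s * (norm v + 1)" using that by (simp add: algebra_simps)
    also have "\<dots> \<le> (e / (2 * (norm v + 1))) * (norm v + 1)"
      using that nv by (intro mult_right_mono) (auto simp: t_def)
    also have "\<dots> = e / 2" using nonzero_mult_div_cancel_right[of "norm v + 1" "e / 2"] nv by simp
    also have "\<dots> < e" using e by simp
    finally have "z + s *\<^sub>R v \<in> ball z e" by (simp add: dist_norm)
    then show ?thesis using e(2) by (auto simp: half_space_def)
  qed
  have "\<exists>s>0. s < t \<and> h (z + t *\<^sub>R v) - h (z + 0 *\<^sub>R v) = (t - 0) * h' (z + s *\<^sub>R v) v"
  proof (rule MVT2[OF t(1)])
    fix s assume s: "0 \<le> s" "s \<le> t"
    have d: "(h has_derivative h' (z + s *\<^sub>R v)) (at (z + s *\<^sub>R v))"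
      using inU[OF s] h by auto
    then show "((\<lambda>s. h (z + s *\<^sub>R v)) has_real_derivative h' (z + s *\<^sub>R v) v) (at s)"
      by (rule has_real_derivative_along_line)
  qed
  then obtain s where s: "0 < s" "s < t" "h (z + t *\<^sub>R v) - h z = t * h' (z + s *\<^sub>R v) v"
    by auto
  have "h' (z + s *\<^sub>R v) v < 0" using d(2)[of s] s t z0 by auto
  then have "t * h' (z + s *\<^sub>R v) v < 0" using t by (simp add: mult_pos_neg)
  moreover have "h z \<le> h (z + t *\<^sub>R v)" using min inU[of t] t by auto
  ultimately show False using s by linarith
qed

section \<open>Hypersurface patches\<close>

text \<open>This is \<open>is_orthonormal_frame\<close> with the chart derivative replaced by an
  arbitrary map \<open>L\<close>, which separates the linear algebra from charts.\<close>

definition frame :: "('d::euclidean_space \<Rightarrow> 'e::euclidean_space) \<Rightarrow> 'd set \<Rightarrow> bool" where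
  "frame L B \<longleftrightarrow> finite B \<and> span B = UNIV \<and> (\<forall>u\<in>B. \<forall>v\<in>B. L u \<bullet> L v = (if u = v then 1 else 0))"

text \<open>Pull back an orthonormal basis of \<open>range L\<close>.\<close>

lemma frame_exists:
  fixes L :: "'d::euclidean_space \<Rightarrow> 'e::euclidean_space"
  assumes L: "linear L" "inj L"
  shows "\<exists>B. frame L B"
proof -
  have sub: "subspace (range L)" using L by (simp add: linear_subspace_image)
  have "\<exists>C. C \<subseteq> range L \<and> pairwise orthogonal C \<and> (\<forall>x\<in>C. norm x = 1) \<and> independent C \<and> span C = range L"
    by (rule orthonormal_basis_subspace[OF sub]) blast
  then obtain C where C: "C \<subseteq> range L" "pairwise orthogonal C" "\<forall>x\<in>C. norm x = 1"
    "independent C" "span C = range L"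
    by blast
  define B where "B = inv L ` C"
  have LB: "L (inv L x) = x" if "x \<in> C" for x using C(1) that by (intro f_inv_into_f) blast
  have fin: "finite C" using C(4) by (rule independent_imp_finite)
  have "L ` B = C" using LB by (force simp: B_def image_image)
  then have "L ` span B = range L" using C(5) L(1) linear_span_image by metis
  then have "span B = UNIV" using L(2) by (simp add: inj_image_eq_iff)
  moreover have "L u \<bullet> L v = (if u = v then 1 else 0)" if uv: "u \<in> B" "v \<in> B" for u v
  proof (cases "u = v")
    case True
    then show ?thesis using uv LB C(3) by (auto simp: B_def dot_square_norm)
  next
    case False
    then show ?thesis using uv LB C(2) by (force simp: B_def pairwise_def orthogonal_def)
  qed
  ultimately show ?thesis unfolding frame_def using fin by (auto simp: B_def)
qed

lemma frame_card:
  fixes L :: "'d::euclidean_space \<Rightarrow> 'e::euclidean_space"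
  assumes L: "linear L" and B: "frame L B"
  shows "card B = DIM('d)"
proof (rule antisym)
  have B': "\<And>u v. u \<in> B \<Longrightarrow> v \<in> B \<Longrightarrow> L u \<bullet> L v = (if u = v then 1 else 0)"
    using B by (simp add: frame_def)
  have "inj_on L B"
  proof (rule inj_onI)
    fix u v assume "u \<in> B" "v \<in> B" "L u = L v"
    then show "u = v" using B'[of u v] B'[of v v] by (simp split: if_splits)
  qed
  have "pairwise orthogonal (L ` B)"
    using B by (auto simp: frame_def pairwise_def orthogonal_def)
  moreover have "0 \<notin> L ` B"
  proof
    assume "0 \<in> L ` B"
    then obtain u where "u \<in> B" "L u = 0" by auto
    then show False using B'[of u u] by simp
  qed
  ultimately have "independent (L ` B)" by (rule pairwise_orthogonal_independent)
  then have "card (L ` B) = dim (L ` B)" by (simp add: dim_eq_card_independent)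
  also have "\<dots> \<le> dim B" by (rule dim_image_le[OF L])
  also have "\<dots> \<le> DIM('d)" by (rule dim_subset_UNIV)
  finally show "card B \<le> DIM('d)" using \<open>inj_on L B\<close> by (simp add: card_image)
  show "DIM('d) \<le> card B"
    using B dim_le_card[of UNIV B] by (simp add: frame_def)
qed

lemma frame_expand:
  assumes L: "linear L" and B: "frame L B"
  shows "v = (\<Sum>b\<in>B. (L v \<bullet> L b) *\<^sub>R b)"
proof -
  have fin: "finite B" using B by (simp add: frame_def)
  have "v \<in> span B" using B by (simp add: frame_def)
  then obtain k where k: "v = (\<Sum>b\<in>B. k b *\<^sub>R b)" using fin by (auto simp: span_finite)
  have "L v \<bullet> L c = k c" if c: "c \<in> B" for c
  proof -
    have "L v \<bullet> L c = (\<Sum>b\<in>B. k b * (L b \<bullet> L c))"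
      using L by (simp add: k linear_sum linear_cmul inner_sum_left)
    also have "\<dots> = (\<Sum>b\<in>B. if b = c then k b else 0)"
      using B c by (intro sum.cong) (auto simp: frame_def)
    also have "\<dots> = k c" using fin c by simp
    finally show ?thesis .
  qed
  then show ?thesis using k by simp
qed

lemma frame_image_expand:
  assumes L: "linear L" and B: "frame L B" and y: "y \<in> range L"
  shows "y = (\<Sum>b\<in>B. (y \<bullet> L b) *\<^sub>R L b)"
proof -
  obtain v where v: "y = L v" using y by auto
  have "L v = L (\<Sum>b\<in>B. (L v \<bullet> L b) *\<^sub>R b)" using frame_expand[OF L B, of v] by simp
  also have "\<dots> = (\<Sum>b\<in>B. (L v \<bullet> L b) *\<^sub>R L b)" using L by (simp add: linear_sum linear_cmul)
  finally show ?thesis using v by simp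
qed

lemma frame_parseval:
  assumes L: "linear L" and B: "frame L B" and y: "y \<in> range L"
  shows "y \<bullet> x = (\<Sum>b\<in>B. (y \<bullet> L b) * (x \<bullet> L b))"
proof -
  have "y \<bullet> x = (\<Sum>b\<in>B. (y \<bullet> L b) *\<^sub>R L b) \<bullet> x" using frame_image_expand[OF L B y] by simp
  also have "\<dots> = (\<Sum>b\<in>B. (y \<bullet> L b) * (x \<bullet> L b))"
    unfolding inner_sum_left by (intro sum.cong refl) (simp add: inner_commute)
  finally show ?thesis .
qed

text \<open>The vector \<open>w\<close> is the orthogonal projection of \<open>x\<close> to
  \<open>range L\<close>. For \<open>x\<close> the position vector, the sum on the left is the
  squared length of its tangential part, a quarter of the squared gradient of |F|^2.\<close>

lemma frame_bessel:
  assumes L: "linear L" and B: "frame L B"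
  shows "(\<Sum>b\<in>B. (x \<bullet> L b)\<^sup>2) \<le> x \<bullet> x"
proof -
  define w where "w = (\<Sum>b\<in>B. (x \<bullet> L b) *\<^sub>R L b)"
  have wx: "w \<bullet> x = (\<Sum>b\<in>B. (x \<bullet> L b)\<^sup>2)"
    unfolding w_def inner_sum_left by (intro sum.cong refl) (simp add: power2_eq_square inner_commute)
  have "w = L (\<Sum>b\<in>B. (x \<bullet> L b) *\<^sub>R b)" using L by (simp add: w_def linear_sum linear_cmul)
  then have "w \<in> range L" by blast
  have fin: "finite B" using B by (simp add: frame_def)
  have "w \<bullet> L c = x \<bullet> L c" if c: "c \<in> B" for c
  proof -
    have "w \<bullet> L c = (\<Sum>b\<in>B. if b = c then x \<bullet> L b else 0)"
      unfolding w_def inner_sum_left using B c by (intro sum.cong) (auto simp: frame_def)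
    then show ?thesis using fin c by simp
  qed
  then have "w \<bullet> w = (\<Sum>b\<in>B. (x \<bullet> L b)\<^sup>2)"
    using frame_parseval[OF L B \<open>w \<in> range L\<close>, of w] by (simp add: power2_eq_square)
  moreover have "0 \<le> (x - w) \<bullet> (x - w)" by simp
  ultimately show ?thesis using wx by (simp add: inner_diff inner_commute)
qed

text \<open>With \<open>P i b = L i \<bullet> L b\<close>, \<open>Q = P\<^sup>T P\<close> and \<open>G = P P\<^sup>T\<close>, the quantity on the left is
  \<open>tr (P a P\<^sup>T (2 - G)) = tr (a (2 Q - Q\<^sup>2)) = tr a - tr (a (1 - Q)\<^sup>2)\<close>, and \<open>1 - Q\<close> has the same
  Frobenius norm as \<open>1 - G\<close>. This replaces the derivative of the inverse metric.\<close>

lemma trace_first_order: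
  fixes L :: "'d::euclidean_space \<Rightarrow> 'e::euclidean_space" and a :: "'d \<Rightarrow> 'd \<Rightarrow> real"
  assumes L: "linear L" and B: "frame L B" and E: "finite E" "card E = card B"
    and a1: "\<And>v. linear (\<lambda>u. a u v)" and a2: "\<And>u. linear (a u)"
    and tr: "(\<Sum>b\<in>B. a b b) = 0" and K: "\<And>b c. b \<in> B \<Longrightarrow> c \<in> B \<Longrightarrow> \<bar>a b c\<bar> \<le> K"
  shows "(\<Sum>i\<in>E. a i i) - (\<Sum>i\<in>E. \<Sum>j\<in>E. (L i \<bullet> L j - (if i = j then 1 else 0)) * a i j)
    \<le> K * (card B)\<^sup>2 * (\<Sum>i\<in>E. \<Sum>j\<in>E. (L i \<bullet> L j - (if i = j then 1 else 0))\<^sup>2)"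
proof -
  have fin: "finite B" using B by (simp add: frame_def)
  define P where "P i b = L i \<bullet> L b" for i b
  define G where "G i j = L i \<bullet> L j" for i j
  define Q where "Q b c = (\<Sum>i\<in>E. P i b * P i c)" for b c
  define R where "R b c = Q b c - (if b = c then 1 else 0)" for b c
  have G: "G i j = (\<Sum>b\<in>B. P i b * P j b)" for i j
    unfolding G_def P_def using frame_parseval[OF L B, of "L i" "L j"] by simp
  have aP: "a i j = (\<Sum>b\<in>B. \<Sum>c\<in>B. P i b * P j c * a b c)" for i j
  proof -
    have "a i j = a (\<Sum>b\<in>B. P i b *\<^sub>R b) j" using frame_expand[OF L B, of i] by (simp add: P_def)
    also have "\<dots> = (\<Sum>b\<in>B. P i b * a b j)" by (simp add: linear_sum[OF a1] linear_cmul[OF a1])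
    also have "\<dots> = (\<Sum>b\<in>B. P i b * a b (\<Sum>c\<in>B. P j c *\<^sub>R c))"
      using frame_expand[OF L B, of j] by (simp add: P_def)
    also have "\<dots> = (\<Sum>b\<in>B. \<Sum>c\<in>B. P i b * P j c * a b c)"
      by (simp add: linear_sum[OF a2] linear_cmul[OF a2] sum_distrib_left mult.assoc)
    finally show ?thesis .
  qed
  have s1: "(\<Sum>i\<in>E. a i i) = (\<Sum>b\<in>B. \<Sum>c\<in>B. a b c * Q b c)"
  proof -
    have "(\<Sum>i\<in>E. a i i) = (\<Sum>i\<in>E. \<Sum>b\<in>B. \<Sum>c\<in>B. P i b * P i c * a b c)" by (intro sum.cong refl aP)
    also have "\<dots> = (\<Sum>b\<in>B. \<Sum>i\<in>E. \<Sum>c\<in>B. P i b * P i c * a b c)" by (rule sum.swap)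
    also have "\<dots> = (\<Sum>b\<in>B. \<Sum>c\<in>B. \<Sum>i\<in>E. P i b * P i c * a b c)" by (intro sum.cong refl sum.swap)
    finally show ?thesis by (simp add: Q_def sum_distrib_left mult_ac)
  qed
  have s2: "(\<Sum>i\<in>E. \<Sum>j\<in>E. G i j * a i j) = (\<Sum>b\<in>B. \<Sum>c\<in>B. a b c * (\<Sum>d\<in>B. Q b d * Q d c))"
  proof -
    have prod: "(\<Sum>d\<in>B. X d) * (\<Sum>b\<in>B. \<Sum>c\<in>B. Y b c) = (\<Sum>b\<in>B. \<Sum>c\<in>B. \<Sum>d\<in>B. X d * Y b c)"
      for X :: "'d \<Rightarrow> real" and Y :: "'d \<Rightarrow> 'd \<Rightarrow> real"
      by (simp add: sum_distrib_left) (simp add: sum_distrib_right)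
    have "(\<Sum>i\<in>E. \<Sum>j\<in>E. G i j * a i j) =
        (\<Sum>i\<in>E. \<Sum>j\<in>E. (\<Sum>d\<in>B. P i d * P j d) * (\<Sum>b\<in>B. \<Sum>c\<in>B. P i b * P j c * a b c))"
      by (intro sum.cong refl arg_cong2[where f=times] G aP)
    also have "\<dots> = (\<Sum>i\<in>E. \<Sum>j\<in>E. \<Sum>b\<in>B. \<Sum>c\<in>B. \<Sum>d\<in>B. a b c * (P i b * P i d) * (P j d * P j c))"
      unfolding prod by (intro sum.cong refl) (simp only: mult_ac)
    also have "\<dots> = (\<Sum>b\<in>B. \<Sum>c\<in>B. \<Sum>d\<in>B. \<Sum>i\<in>E. \<Sum>j\<in>E. a b c * (P i b * P i d) * (P j d * P j c))"
      by (simp only: sum.swap[of _ B E])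
    also have "\<dots> = (\<Sum>b\<in>B. \<Sum>c\<in>B. a b c * (\<Sum>d\<in>B. Q b d * Q d c))"
      unfolding Q_def unfolding sum_product unfolding sum_distrib_left by (intro sum.cong refl) (simp only: mult_ac)
    finally show ?thesis .
  qed
  \<comment> \<open>Entrywise expansion of (Q - 1)^2 = Q^2 - 2 Q + 1.\<close>
  have Qd: "(\<Sum>d\<in>B. R b d * R d c) = (\<Sum>d\<in>B. Q b d * Q d c) - 2 * Q b c + (if b = c then 1 else 0)"
    if "b \<in> B" "c \<in> B" for b c
  proof -
    have "R b d * R d c = Q b d * Q d c - (if d = c then Q b d else 0) - (if b = d then Q d c else 0)
        + (if b = d then (if d = c then 1 else 0) else 0)" for d
      by (simp add: R_def algebra_simps)
    then show ?thesis
      using fin that by (simp add: sum.distrib sum_subtractf)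
  qed
  have ident: "(\<Sum>i\<in>E. a i i) - (\<Sum>i\<in>E. \<Sum>j\<in>E. (G i j - (if i = j then 1 else 0)) * a i j)
      = - (\<Sum>b\<in>B. \<Sum>c\<in>B. a b c * (\<Sum>d\<in>B. R b d * R d c))"
  proof -
    have "(\<Sum>i\<in>E. \<Sum>j\<in>E. (G i j - (if i = j then 1 else 0)) * a i j)
        = (\<Sum>i\<in>E. \<Sum>j\<in>E. G i j * a i j) - (\<Sum>i\<in>E. \<Sum>j\<in>E. if i = j then a i j else 0)"
      unfolding sum_subtractf[symmetric] by (intro sum.cong refl) (simp add: algebra_simps)
    moreover have "(\<Sum>i\<in>E. \<Sum>j\<in>E. if i = j then a i j else 0) = (\<Sum>i\<in>E. a i i)" using E by simp
    moreover have "(\<Sum>b\<in>B. \<Sum>c\<in>B. a b c * (\<Sum>d\<in>B. R b d * R d c)) =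
        (\<Sum>b\<in>B. \<Sum>c\<in>B. a b c * (\<Sum>d\<in>B. Q b d * Q d c) - 2 * (a b c * Q b c) + (if b = c then a b c else 0))"
      by (intro sum.cong refl) (simp add: Qd algebra_simps)
    moreover have "\<dots> = (\<Sum>b\<in>B. \<Sum>c\<in>B. a b c * (\<Sum>d\<in>B. Q b d * Q d c))
        - 2 * (\<Sum>b\<in>B. \<Sum>c\<in>B. a b c * Q b c) + (\<Sum>b\<in>B. a b b)"
      using fin by (simp add: sum.distrib sum_subtractf sum_distrib_left)
    ultimately show ?thesis using s1 s2 tr by linarith
  qed
  \<comment> \<open>Cyclicity of the trace: tr (P^T P P^T P) = tr (P P^T P P^T).\<close>
  have QQ: "(\<Sum>b\<in>B. \<Sum>c\<in>B. (Q b c)\<^sup>2) = (\<Sum>i\<in>E. \<Sum>j\<in>E. (G i j)\<^sup>2)"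
  proof -
    have "(\<Sum>b\<in>B. \<Sum>c\<in>B. (Q b c)\<^sup>2) = (\<Sum>b\<in>B. \<Sum>c\<in>B. \<Sum>i\<in>E. \<Sum>j\<in>E. P i b * P i c * (P j b * P j c))"
      unfolding Q_def power2_eq_square sum_product ..
    also have "\<dots> = (\<Sum>i\<in>E. \<Sum>j\<in>E. \<Sum>b\<in>B. \<Sum>c\<in>B. P i b * P i c * (P j b * P j c))"
      by (simp only: sum.swap[of _ E B])
    also have "\<dots> = (\<Sum>i\<in>E. \<Sum>j\<in>E. (G i j)\<^sup>2)"
      unfolding G power2_eq_square sum_product by (intro sum.cong refl) (simp only: mult_ac)
    finally show ?thesis .
  qed
  have trQ: "(\<Sum>b\<in>B. Q b b) = (\<Sum>i\<in>E. G i i)"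
    unfolding Q_def G by (rule sum.swap)
  have RG: "(\<Sum>b\<in>B. \<Sum>c\<in>B. (R b c)\<^sup>2) = (\<Sum>i\<in>E. \<Sum>j\<in>E. (G i j - (if i = j then 1 else 0))\<^sup>2)"
  proof -
    \<comment> \<open>This is |H - 1|^2 = |H|^2 - 2 tr H + card A. All three terms agree for
      \<open>Q\<close> over \<open>B\<close> and \<open>G\<close> over \<open>E\<close>, the last
      one because \<open>card E = card B\<close>.\<close>
    have *: "(\<Sum>b\<in>A. \<Sum>c\<in>A. (H b c - (if b = c then 1 else 0))\<^sup>2) =
        (\<Sum>b\<in>A. \<Sum>c\<in>A. (H b c)\<^sup>2) - 2 * (\<Sum>b\<in>A. H b b) + card A"
      if A: "finite A" for A :: "'d set" and H :: "'d \<Rightarrow> 'd \<Rightarrow> real"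
    proof -
      have "(\<Sum>b\<in>A. \<Sum>c\<in>A. (H b c - (if b = c then 1 else 0))\<^sup>2) =
          (\<Sum>b\<in>A. \<Sum>c\<in>A. (H b c)\<^sup>2 - (if b = c then 2 * H b c else 0) + (if b = c then 1 else 0))"
        by (intro sum.cong refl) (simp add: power2_eq_square algebra_simps)
      also have "\<dots> = (\<Sum>b\<in>A. \<Sum>c\<in>A. (H b c)\<^sup>2) - 2 * (\<Sum>b\<in>A. H b b) + card A"
        using A by (simp add: sum.distrib sum_subtractf sum_distrib_left)
      finally show ?thesis .
    qed
    show ?thesis unfolding R_def *[OF fin] *[OF E(1)] QQ trQ E(2) ..
  qed
  define m where "m = (\<Sum>b\<in>B. \<Sum>c\<in>B. (R b c)\<^sup>2)"
  have m1: "(\<Sum>d\<in>B. (R b d)\<^sup>2) \<le> m" if "b \<in> B" for b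
    unfolding m_def using fin that
    by (intro member_le_sum[where f="\<lambda>b. \<Sum>c\<in>B. (R b c)\<^sup>2"] sum_nonneg) auto
  have Rsym: "R b c = R c b" for b c by (cases "b = c") (auto simp: R_def Q_def mult.commute)
  \<comment> \<open>Entries of R^2 are products of two rows of the symmetric matrix
    \<open>R\<close>; the arithmetic-geometric mean inequality bounds them by its squared Frobenius
    norm \<open>m\<close>.\<close>
  have RR: "\<bar>\<Sum>d\<in>B. R b d * R d c\<bar> \<le> m" if "b \<in> B" "c \<in> B" for b c
  proof -
    have "\<bar>\<Sum>d\<in>B. R b d * R d c\<bar> \<le> (\<Sum>d\<in>B. \<bar>R b d * R d c\<bar>)" by (rule sum_abs)
    also have "\<dots> \<le> (\<Sum>d\<in>B. ((R b d)\<^sup>2 + (R c d)\<^sup>2) / 2)"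
    proof (rule sum_mono)
      fix d
      have "0 \<le> (\<bar>R b d\<bar> - \<bar>R c d\<bar>)\<^sup>2" by simp
      then show "\<bar>R b d * R d c\<bar> \<le> ((R b d)\<^sup>2 + (R c d)\<^sup>2) / 2"
        by (simp add: Rsym[of d c] power2_eq_square abs_mult algebra_simps)
    qed
    also have "\<dots> = ((\<Sum>d\<in>B. (R b d)\<^sup>2) + (\<Sum>d\<in>B. (R c d)\<^sup>2)) / 2"
      by (simp add: sum.distrib sum_divide_distrib[symmetric])
    also have "\<dots> \<le> m" using m1[OF that(1)] m1[OF that(2)] by simp
    finally show ?thesis .
  qed
  have "- (\<Sum>b\<in>B. \<Sum>c\<in>B. a b c * (\<Sum>d\<in>B. R b d * R d c)) \<le>
      \<bar>\<Sum>b\<in>B. \<Sum>c\<in>B. a b c * (\<Sum>d\<in>B. R b d * R d c)\<bar>" by simp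
  also have "\<dots> \<le> (\<Sum>b\<in>B. \<Sum>c\<in>B. \<bar>a b c * (\<Sum>d\<in>B. R b d * R d c)\<bar>)"
    by (rule order_trans[OF sum_abs sum_mono[OF sum_abs]])
  also have "\<dots> \<le> (\<Sum>b\<in>B. \<Sum>c\<in>B. K * m)"
  proof (intro sum_mono)
    fix b c assume bc: "b \<in> B" "c \<in> B"
    have "0 \<le> K" using K[OF bc] by linarith
    then show "\<bar>a b c * (\<Sum>d\<in>B. R b d * R d c)\<bar> \<le> K * m"
      unfolding abs_mult using K[OF bc] RR[OF bc] by (intro mult_mono) auto
  qed
  also have "\<dots> = K * (card B)\<^sup>2 * m" by (simp add: power2_eq_square)
  finally show ?thesis unfolding m_def RG unfolding ident[symmetric] unfolding G_def .
qed

section \<open>Structure equations of a hypersurface, up to the boundary\<close>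

text \<open>\<open>f\<close> and \<open>g\<close> are local extensions of the immersion and of its
  normal to an open set that may cross the boundary of the half-space. Regularity is assumed on all
  of \<open>U\<close>, geometry only on the half-space part.\<close>

locale hypersurface_patch =
  fixes U :: "'d::euclidean_space set"
    and f g :: "'d \<Rightarrow> 'e::euclidean_space" and Df Dg :: "'d \<Rightarrow> 'd \<Rightarrow> 'e"
    and D2f D2g :: "'d \<Rightarrow> 'd \<Rightarrow> 'd \<Rightarrow> 'e"
  assumes dim: "DIM('e) = DIM('d) + 1"
    and f_jet: "C2_jet U f Df D2f" and g_jet: "C2_jet U g Dg D2g"
    and inj: "z \<in> U \<inter> half_space \<Longrightarrow> inj (Df z)"
    and unit: "z \<in> U \<inter> half_space \<Longrightarrow> g z \<bullet> g z = 1"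
    and normal: "z \<in> U \<inter> half_space \<Longrightarrow> Df z v \<bullet> g z = 0"
begin

lemma open_U: "open U"
  using C2_jetD(1)[OF f_jet] .

lemmas df = C2_jetD(2)[OF f_jet] and d2f = C2_jetD(3)[OF f_jet]
  and dg = C2_jetD(2)[OF g_jet] and d2g = C2_jetD(3)[OF g_jet]

lemmas f_linear = C2_jet_linear[OF f_jet] and g_linear = C2_jet_linear[OF g_jet]

text \<open>Codimension one enters here: the tangent space lies in the hyperplane orthogonal to
  \<open>g z\<close> and has the same dimension.\<close>

lemma tangent_range:
  assumes z: "z \<in> U \<inter> half_space" and y: "y \<bullet> g z = 0"
  shows "\<exists>v. Df z v = y"
proof -
  have lin: "linear (Df z)" using f_linear z by blast
  have "range (Df z) \<subseteq> {x. g z \<bullet> x = 0}" using normal[OF z] by (auto simp: inner_commute)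
  moreover have "subspace (range (Df z))" using lin by (simp add: linear_subspace_image)
  moreover have "dim (range (Df z)) = DIM('d)"
    using dim_image_eq[OF lin, of UNIV] inj[OF z] by simp
  moreover have "g z \<noteq> 0" using unit[OF z] by auto
  then have "dim {x. g z \<bullet> x = 0} = DIM('e) - 1" by (rule dim_hyperplane)
  ultimately have "range (Df z) = {x. g z \<bullet> x = 0}"
    using dim by (intro subspace_dim_equal subspace_hyperplane) auto
  then show ?thesis using y by (metis (mono_tags, lifting) inner_commute mem_Collect_eq rangeE)
qed

lemma normal_deriv: "z \<in> U \<inter> half_space \<Longrightarrow> Dg z v \<bullet> g z = 0"
proof -
  assume z: "z \<in> U \<inter> half_space"
  have "((\<lambda>y. g y \<bullet> g y) has_derivative (\<lambda>v. g z \<bullet> Dg z v + Dg z v \<bullet> g z)) (at z)"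
    using dg z by (auto intro!: derivative_eq_intros)
  then have "g z \<bullet> Dg z v + Dg z v \<bullet> g z = 0"
    using z open_U unit by (intro half_space_deriv_zero[where h="\<lambda>y. g y \<bullet> g y" and U=U and z=z]) auto
  then show ?thesis by (simp add: inner_commute)
qed

lemma weingarten: "z \<in> U \<inter> half_space \<Longrightarrow> Dg z u \<bullet> Df z v = - (D2f z u v \<bullet> g z)"
proof -
  assume z: "z \<in> U \<inter> half_space"
  have "((\<lambda>y. Df y v \<bullet> g y) has_derivative (\<lambda>u. Df z v \<bullet> Dg z u + D2f z u v \<bullet> g z)) (at z)"
    using dg d2f z by (auto intro!: derivative_eq_intros)
  then have "Df z v \<bullet> Dg z u + D2f z u v \<bullet> g z = 0"
    using z open_U normal by (intro half_space_deriv_zero[where h="\<lambda>y. Df y v \<bullet> g y" and U=U and z=z]) auto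
  then show ?thesis by (simp add: inner_commute)
qed

lemma weingarten_sym: "z \<in> U \<inter> half_space \<Longrightarrow> Dg z u \<bullet> Df z v = Dg z v \<bullet> Df z u"
  using weingarten symmetric_second_derivative[OF f_jet] by (metis IntD1)

text \<open>Obtained by differentiating the symmetry of the second fundamental form. Together with
  the symmetry of \<open>D2g\<close> it serves as the Codazzi equation; since the form is written
  through \<open>Dg\<close>, third derivatives of \<open>f\<close> never appear.\<close>

lemma weingarten_deriv:
  assumes z: "z \<in> U \<inter> half_space"
  shows "D2g z w u \<bullet> Df z v + Dg z u \<bullet> D2f z w v = D2g z w v \<bullet> Df z u + Dg z v \<bullet> D2f z w u"
proof -
  have "((\<lambda>y. Dg y u \<bullet> Df y v - Dg y v \<bullet> Df y u) has_derivative
      (\<lambda>w. (Dg z u \<bullet> D2f z w v + D2g z w u \<bullet> Df z v) - (Dg z v \<bullet> D2f z w u + D2g z w v \<bullet> Df z u))) (at z)"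
    using d2g d2f z by (auto intro!: derivative_eq_intros)
  then have "(Dg z u \<bullet> D2f z w v + D2g z w u \<bullet> Df z v) - (Dg z v \<bullet> D2f z w u + D2g z w v \<bullet> Df z u) = 0"
    using z open_U weingarten_sym
    by (intro half_space_deriv_zero[where h="\<lambda>y. Dg y u \<bullet> Df y v - Dg y v \<bullet> Df y u" and U=U and z=z]) auto
  then show ?thesis by simp
qed

text \<open>Differentiates \<open>normal_deriv\<close> once more. Traced over a frame, the right
  side becomes -|A|^2, the zeroth-order term in the Laplacian of the normal.\<close>

lemma normal_deriv2:
  assumes z: "z \<in> U \<inter> half_space"
  shows "D2g z u v \<bullet> g z = - (Dg z v \<bullet> Dg z u)"
proof -
  have "((\<lambda>y. Dg y v \<bullet> g y) has_derivative (\<lambda>u. Dg z v \<bullet> Dg z u + D2g z u v \<bullet> g z)) (at z)"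
    using dg d2g z by (auto intro!: derivative_eq_intros)
  then have "Dg z v \<bullet> Dg z u + D2g z u v \<bullet> g z = 0"
    using z open_U normal_deriv by (intro half_space_deriv_zero[where h="\<lambda>y. Dg y v \<bullet> g y" and U=U and z=z]) auto
  then show ?thesis by (simp add: inner_commute)
qed

section \<open>First-order minimum arguments at free boundary points\<close>

text \<open>On the boundary |f|^2 attains its maximal value 1, so a direction in which it grows
  cannot point inward. The conclusion is the admissibility condition of
  \<open>inward_min_deriv_nonneg\<close> for \<open>- w\<close>.\<close>

lemma boundary_outward:
  assumes z: "z \<in> U \<inter> half_space" and ball: "\<And>y. y \<in> U \<inter> half_space \<Longrightarrow> f y \<bullet> f y \<le> 1"
    and bd: "z \<bullet> inward_dir = 0 \<Longrightarrow> f z \<bullet> f z = 1" and w: "z \<bullet> inward_dir = 0 \<Longrightarrow> 0 < f z \<bullet> Df z w"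
  shows "0 < z \<bullet> inward_dir \<or> 0 \<le> (- w) \<bullet> inward_dir"
proof (rule ccontr)
  assume "\<not> ?thesis"
  then have b: "z \<bullet> inward_dir = 0" "0 \<le> w \<bullet> inward_dir"
    using z by (auto simp: half_space_def)
  have "0 \<le> - (f z \<bullet> Df z w + Df z w \<bullet> f z)"
    by (rule inward_min_deriv_nonneg[where h="\<lambda>y. - (f y \<bullet> f y)" and U=U and z=z])
       (use df z open_U ball bd b in \<open>auto intro!: derivative_eq_intros\<close>)
  then show False using w[OF b(1)] by (simp add: inner_commute)
qed

text \<open>The vector \<open>y\<close> is the radial direction. Differentiating f . g = 0 makes f z
  orthogonal to every \<open>Dg z w\<close>; by symmetry of the second fundamental form,
  \<open>Dg z y\<close> is then orthogonal to all tangent vectors, and it is itself tangent.\<close>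

lemma conical_deriv:
  assumes z: "z \<in> U \<inter> half_space" and cone: "\<And>y. y \<in> U \<inter> half_space \<Longrightarrow> f y \<bullet> g y = 0"
  obtains y where "Df z y = f z" "Dg z y = 0"
proof -
  obtain y where y: "Df z y = f z" using tangent_range[OF z cone[OF z]] by blast
  have "f z \<bullet> Dg z w = 0" for w
  proof -
    have "((\<lambda>y. f y \<bullet> g y) has_derivative (\<lambda>w. f z \<bullet> Dg z w + Df z w \<bullet> g z)) (at z)"
      using df dg z by (auto intro!: derivative_eq_intros)
    then have "f z \<bullet> Dg z w + Df z w \<bullet> g z = 0"
      using z open_U cone by (intro half_space_deriv_zero[where h="\<lambda>y. f y \<bullet> g y" and U=U and z=z]) auto
    then show ?thesis using normal[OF z] by simp
  qed
  then have "Dg z y \<bullet> Df z w = 0" for w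
    using weingarten_sym[OF z, of y w] y by (simp add: inner_commute)
  moreover obtain w where "Df z w = Dg z y"
    using tangent_range[OF z normal_deriv[OF z]] by blast
  ultimately have "Dg z y = 0" by (metis inner_eq_zero_iff)
  then show ?thesis using that y by blast
qed

text \<open>Along the radial direction towards the origin, \<open>g\<close> is stationary while
  |f|^2 decreases at rate 2 |f|^2, and at a boundary point that direction points into the
  half-space.\<close>

lemma conical_min_at_origin:
  assumes z: "z \<in> U \<inter> half_space" and cone: "\<And>y. y \<in> U \<inter> half_space \<Longrightarrow> f y \<bullet> g y = 0"
    and ball: "\<And>y. y \<in> U \<inter> half_space \<Longrightarrow> f y \<bullet> f y \<le> 1"
    and bd: "z \<bullet> inward_dir = 0 \<Longrightarrow> f z \<bullet> f z = 1"
    and \<psi>: "\<psi> differentiable (at (g z))" and \<epsilon>: "0 < \<epsilon>"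
    and min: "\<And>y. y \<in> U \<inter> half_space \<Longrightarrow> \<psi> (g z) + \<epsilon> * (f z \<bullet> f z) \<le> \<psi> (g y) + \<epsilon> * (f y \<bullet> f y)"
  shows "f z = 0"
proof -
  obtain y where y: "Df z y = f z" "Dg z y = 0" using conical_deriv[OF z cone] by blast
  obtain \<psi>' where \<psi>': "(\<psi> has_derivative \<psi>') (at (g z))" using \<psi> by (auto simp: differentiable_def)
  have "0 \<le> \<psi>' (Dg z (- y)) + \<epsilon> * (f z \<bullet> Df z (- y) + Df z (- y) \<bullet> f z)"
  proof (rule inward_min_deriv_nonneg[where h="\<lambda>y. \<psi> (g y) + \<epsilon> * (f y \<bullet> f y)" and U=U and z=z
        and h'="\<lambda>v. \<psi>' (Dg z v) + \<epsilon> * (f z \<bullet> Df z v + Df z v \<bullet> f z)"])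
    show "((\<lambda>y. \<psi> (g y) + \<epsilon> * (f y \<bullet> f y)) has_derivative
        (\<lambda>v. \<psi>' (Dg z v) + \<epsilon> * (f z \<bullet> Df z v + Df z v \<bullet> f z))) (at z)"
      using has_derivative_compose[OF dg \<psi>'] df z
      by (auto intro!: has_derivative_add has_derivative_mult_right has_derivative_inner)
    show "0 < z \<bullet> inward_dir \<or> 0 \<le> - y \<bullet> inward_dir"
      by (rule boundary_outward[OF z ball bd]) (use bd y in auto)
  qed (use z open_U min in auto)
  moreover have "Dg z (- y) = 0" "Df z (- y) = - f z"
    using y f_linear(1) g_linear(1) z by (auto simp: linear_neg)
  moreover have "\<psi>' 0 = 0" using has_derivative_linear[OF \<psi>'] linear_0 by blast
  ultimately have "f z \<bullet> f z \<le> 0" using \<epsilon> by (simp add: mult_le_0_iff)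
  then show ?thesis by (metis inner_eq_zero_iff inner_ge_zero order_antisym)
qed

text \<open>The vector from \<open>f z\<close> to \<zeta> is tangent, and moving along it strictly
  decreases the distance unless they coincide. Since \<zeta> is strictly inside the ball, this
  direction is admissible at boundary points as well.\<close>

lemma planar_min_distance:
  assumes z: "z \<in> U \<inter> half_space"
    and ball: "\<And>y. y \<in> U \<inter> half_space \<Longrightarrow> f y \<bullet> f y \<le> 1"
    and bd: "z \<bullet> inward_dir = 0 \<Longrightarrow> f z \<bullet> f z = 1"
    and plane: "f z \<bullet> g z = 0" "\<zeta> \<bullet> g z = 0" and \<zeta>: "norm \<zeta> < 1"
    and V: "open V" "z \<in> V" "V \<subseteq> U" and min: "\<And>y. y \<in> V \<inter> half_space \<Longrightarrow> dist (f z) \<zeta> \<le> dist (f y) \<zeta>"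
  shows "f z = \<zeta>"
proof -
  obtain y where y: "Df z y = \<zeta> - f z"
    using tangent_range[OF z, of "\<zeta> - f z"] plane by (auto simp: inner_diff)
  have lin: "linear (Df z)" using f_linear z by blast
  have "0 \<le> (f z - \<zeta>) \<bullet> Df z y + Df z y \<bullet> (f z - \<zeta>)"
  proof (rule inward_min_deriv_nonneg[where h="\<lambda>y. (f y - \<zeta>) \<bullet> (f y - \<zeta>)" and U=V and z=z
        and h'="\<lambda>v. (f z - \<zeta>) \<bullet> Df z v + Df z v \<bullet> (f z - \<zeta>)"])
    show "((\<lambda>y. (f y - \<zeta>) \<bullet> (f y - \<zeta>)) has_derivative (\<lambda>v. (f z - \<zeta>) \<bullet> Df z v + Df z v \<bullet> (f z - \<zeta>))) (at z)"
      using df z by (auto intro!: derivative_eq_intros)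
    have "0 < z \<bullet> inward_dir \<or> 0 \<le> - (- y) \<bullet> inward_dir"
    proof (rule boundary_outward[OF z ball bd])
      assume b: "z \<bullet> inward_dir = 0"
      \<comment> \<open>The outward derivative is f z . (f z - \<zeta>) = 1 - f z . \<zeta>,
        positive by Cauchy-Schwarz.\<close>
      have "f z \<bullet> \<zeta> \<le> norm (f z) * norm \<zeta>" by (rule norm_cauchy_schwarz)
      also have "\<dots> < 1" using bd[OF b] \<zeta> by (simp add: norm_eq_sqrt_inner)
      finally show "0 < f z \<bullet> Df z (- y)"
        using bd[OF b] y lin by (simp add: linear_neg inner_diff)
    qed
    then show "0 < z \<bullet> inward_dir \<or> 0 \<le> y \<bullet> inward_dir" by simp
    show "(f z - \<zeta>) \<bullet> (f z - \<zeta>) \<le> (f y - \<zeta>) \<bullet> (f y - \<zeta>)" if "y \<in> V \<inter> half_space" for y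
      using min[OF that] by (simp add: dist_norm norm_le)
  qed (use V z in auto)
  also have "\<dots> = - 2 * ((f z - \<zeta>) \<bullet> (f z - \<zeta>))" by (simp add: y algebra_simps inner_commute)
  finally have "(f z - \<zeta>) \<bullet> (f z - \<zeta>) \<le> 0" by simp
  then have "f z - \<zeta> = 0" by (metis inner_eq_zero_iff inner_ge_zero order_antisym)
  then show ?thesis by simp
qed

lemma locally_injective:
  assumes z: "z \<in> U \<inter> half_space"
  obtains r where "0 < r" "ball z r \<subseteq> U" "inj_on f (ball z r)"
proof -
  have lin: "linear (Df z)" using f_linear z by blast
  obtain h where h: "linear h" "h \<circ> Df z = id"
    using linear_injective_left_inverse[OF lin inj[OF z]] by blast
  show ?thesis
  proof (rule has_derivative_locally_injective[of z U h Df f])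
    fix e :: real assume e: "e > 0"
    \<comment> \<open>Control on each basis vector by \<open>c\<close> adds up over
      \<open>DIM('d)\<close> of them to the operator norm bound e/2.\<close>
    define c where "c = e / (2 * DIM('d))"
    have c: "c > 0" using e by (simp add: c_def)
    have "\<forall>b\<in>Basis. eventually (\<lambda>x. norm (Df x b - Df z b) < c) (nhds z)"
    proof
      fix b :: 'd
      have "isCont (\<lambda>x. Df x b) z" using d2f z has_derivative_continuous by blast
      then have "((\<lambda>x. Df x b) \<longlongrightarrow> Df z b) (nhds z)"
        unfolding isCont_def by (rule tendsto_at_iff_tendsto_nhds[of "\<lambda>x. Df x b" z, THEN iffD1])
      from tendstoD[OF this c] show "eventually (\<lambda>x. norm (Df x b - Df z b) < c) (nhds z)"
        by (simp add: dist_norm)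
    qed
    then have "eventually (\<lambda>x. \<forall>b\<in>Basis. norm (Df x b - Df z b) < c) (nhds z)"
      by (simp add: eventually_ball_finite_distrib)
    moreover have "eventually (\<lambda>x. x \<in> U) (nhds z)" using open_U z eventually_nhds_in_open by blast
    ultimately have "eventually (\<lambda>x. onorm (\<lambda>v. Df x v - Df z v) < e) (nhds z)"
    proof eventually_elim
      case (elim x)
      have linx: "linear (\<lambda>v. Df x v - Df z v)"
        using lin f_linear(1)[OF elim(2)] by (intro linear_compose_sub)
      have "onorm (\<lambda>v. Df x v - Df z v) \<le> e / 2"
      proof (rule onorm_le)
        fix v :: 'd
        have "Df x v - Df z v = (\<Sum>b\<in>Basis. (v \<bullet> b) *\<^sub>R (Df x b - Df z b))"
          using linear_sum[OF linx] linear_cmul[OF linx] euclidean_representation[of v]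
          by (metis (no_types, lifting) sum.cong)
        then have "norm (Df x v - Df z v) \<le> (\<Sum>b\<in>Basis. norm ((v \<bullet> b) *\<^sub>R (Df x b - Df z b)))"
          by (metis norm_sum)
        also have "\<dots> \<le> (\<Sum>b\<in>(Basis::'d set). norm v * c)"
        proof (rule sum_mono)
          fix b :: 'd assume b: "b \<in> Basis"
          then have "norm (Df x b - Df z b) \<le> c" using elim(1) by (simp add: less_imp_le)
          then show "norm ((v \<bullet> b) *\<^sub>R (Df x b - Df z b)) \<le> norm v * c"
            unfolding norm_scaleR using Basis_le_norm[OF b] by (intro mult_mono) auto
        qed
        also have "\<dots> = e / 2 * norm v" by (simp add: c_def)
        finally show "norm (Df x v - Df z v) \<le> e / 2 * norm v" .
      qed
      then show ?case using e by simp
    qed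
    then show "\<exists>d>0. \<forall>x. dist z x < d \<longrightarrow> onorm (\<lambda>v. Df x v - Df z v) < e"
      unfolding eventually_nhds_metric by (simp add: dist_commute)
  qed (use z open_U h df that in \<open>auto simp: linear_conv_bounded_linear\<close>)
qed

end

section \<open>Traced Codazzi equation, Laplacian of the normal, and comparison\<close>

text \<open>The frame is existentially quantified at each point separately: nothing relates the
  frames at neighbouring points, not even continuity.\<close>

locale minimal_patch = hypersurface_patch U f g Df Dg D2f D2g
  for U :: "'d::euclidean_space set" and f g :: "'d \<Rightarrow> 'e::euclidean_space"
    and Df Dg :: "'d \<Rightarrow> 'd \<Rightarrow> 'e" and D2f D2g :: "'d \<Rightarrow> 'd \<Rightarrow> 'd \<Rightarrow> 'e" +
  assumes curvature: "z \<in> U \<inter> half_space \<Longrightarrow> \<exists>B. frame (Df z) B \<and> (\<Sum>b\<in>B. D2f z b b \<bullet> g z) = 0 \<and>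
    (\<Sum>b\<in>B. \<Sum>c\<in>B. (D2f z b c \<bullet> g z)\<^sup>2) \<le> 2 * real DIM('d)"
begin

text \<open>This is the derivative of the equation H = 0. The frame \<open>E\<close> at
  \<open>z\<close> is kept fixed at nearby points, where it is no longer orthonormal;
  \<open>trace_first_order\<close> says that the corrected trace is at most a constant times the
  squared metric error. Hence \<open>h\<close> is nonnegative and vanishes at \<open>z\<close>, so
  its derivative there is zero, and the quadratic term contributes nothing to it.\<close>

lemma trace_codazzi:
  assumes z: "z \<in> U" "0 < z \<bullet> inward_dir" and E: "frame (Df z) E" and tr: "(\<Sum>e\<in>E. D2f z e e \<bullet> g z) = 0"
  shows "(\<Sum>e\<in>E. Dg z e \<bullet> D2f z w e) = (\<Sum>e\<in>E. D2g z w e \<bullet> Df z e)"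
proof -
  have zh: "z \<in> U \<inter> half_space" using z by (auto simp: half_space_def)
  have lin: "linear (Df z)" using f_linear z by blast
  \<comment> \<open>Each coefficient of the second fundamental form in an orthonormal frame has
    square at most |A|^2, hence at most 2n; the second factor is the squared frame size from
    \<open>trace_first_order\<close>.\<close>
  define K where "K = sqrt (2 * real DIM('d)) * (DIM('d))\<^sup>2"
  define G where "G y i j = Df y i \<bullet> Df y j - (if i = j then 1 else 0)" for y i j
  define a where "a y i j = Dg y i \<bullet> Df y j" for y i j
  define h where "h y = K * (\<Sum>i\<in>E. \<Sum>j\<in>E. G y i j * G y i j) -
    ((\<Sum>i\<in>E. a y i i) - (\<Sum>i\<in>E. \<Sum>j\<in>E. G y i j * a y i j))" for y
  define G' where "G' w i j = Df z i \<bullet> D2f z w j + D2f z w i \<bullet> Df z j" for w i j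
  define a' where "a' w i j = Dg z i \<bullet> D2f z w j + D2g z w i \<bullet> Df z j" for w i j
  have h_nonneg: "0 \<le> h y" if y: "y \<in> U \<inter> half_space" for y
  proof -
    obtain B where B: "frame (Df y) B" "(\<Sum>b\<in>B. D2f y b b \<bullet> g y) = 0"
      and A2: "(\<Sum>b\<in>B. \<Sum>c\<in>B. (D2f y b c \<bullet> g y)\<^sup>2) \<le> 2 * real DIM('d)"
      using curvature[OF y] by blast
    have yU: "y \<in> U" using y by simp
    have fin: "finite B" using B by (simp add: frame_def)
    have cardB: "card B = DIM('d)" using frame_card[OF f_linear(1)[OF yU] B(1)] .
    have cardE: "card E = DIM('d)" "finite E"
      using frame_card[OF lin E] E by (auto simp: frame_def)
    have "(\<Sum>i\<in>E. a y i i) - (\<Sum>i\<in>E. \<Sum>j\<in>E. (Df y i \<bullet> Df y j - (if i = j then 1 else 0)) * a y i j)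
      \<le> sqrt (2 * real DIM('d)) * (card B)\<^sup>2 * (\<Sum>i\<in>E. \<Sum>j\<in>E. (Df y i \<bullet> Df y j - (if i = j then 1 else 0))\<^sup>2)"
    proof (rule trace_first_order[OF f_linear(1)[OF yU] B(1)])
      show "linear (\<lambda>u. a y u v)" for v
        unfolding a_def using g_linear(1)[OF yU]
        by (auto intro!: linearI simp: linear_add linear_cmul inner_add_left)
      show "linear (a y u)" for u
        unfolding a_def using f_linear(1)[OF yU]
        by (auto intro!: linearI simp: linear_add linear_cmul inner_add_right)
      show "(\<Sum>b\<in>B. a y b b) = 0" using B(2) by (simp add: a_def weingarten[OF y] sum_negf)
      fix b c assume bc: "b \<in> B" "c \<in> B"
      have "(D2f y b c \<bullet> g y)\<^sup>2 \<le> (\<Sum>c\<in>B. (D2f y b c \<bullet> g y)\<^sup>2)"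
        using fin bc by (intro member_le_sum) auto
      also have "\<dots> \<le> (\<Sum>b\<in>B. \<Sum>c\<in>B. (D2f y b c \<bullet> g y)\<^sup>2)"
        using fin bc by (intro member_le_sum[where f="\<lambda>b. \<Sum>c\<in>B. (D2f y b c \<bullet> g y)\<^sup>2"] sum_nonneg) auto
      also note A2
      finally have "(a y b c)\<^sup>2 \<le> 2 * real DIM('d)" by (simp add: a_def weingarten[OF y])
      then show "\<bar>a y b c\<bar> \<le> sqrt (2 * real DIM('d))"
        using real_sqrt_le_mono by fastforce
    qed (use cardB cardE in auto)
    then show ?thesis unfolding h_def K_def cardB G_def power2_eq_square by simp
  qed
  have Gz: "G z i j = 0" if "i \<in> E" "j \<in> E" for i j
    using E that by (simp add: G_def frame_def)
  have h_z: "h z = 0"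
    using tr by (simp add: h_def Gz a_def weingarten[OF zh] sum_negf)
  have dG: "((\<lambda>y. G y i j) has_derivative (\<lambda>w. G' w i j)) (at z)" for i j
    unfolding G_def G'_def using d2f[OF z(1)] by (auto intro!: derivative_eq_intros)
  have da: "((\<lambda>y. a y i j) has_derivative (\<lambda>w. a' w i j)) (at z)" for i j
    unfolding a_def a'_def using d2f[OF z(1)] d2g[OF z(1)] by (auto intro!: derivative_eq_intros)
  have "(h has_derivative (\<lambda>w. K * (\<Sum>i\<in>E. \<Sum>j\<in>E. G z i j * G' w i j + G' w i j * G z i j) -
      ((\<Sum>i\<in>E. a' w i i) - (\<Sum>i\<in>E. \<Sum>j\<in>E. G z i j * a' w i j + G' w i j * a z i j)))) (at z)"
    unfolding h_def by (intro has_derivative_diff has_derivative_mult_right has_derivative_sum has_derivative_mult dG da)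
  from interior_min_deriv_zero[OF this open_U z, of w] h_nonneg h_z
  have "(\<Sum>i\<in>E. a' w i i) = (\<Sum>i\<in>E. \<Sum>j\<in>E. G' w i j * a z i j)"
    by (simp add: Gz)
  also have "\<dots> = (\<Sum>i\<in>E. \<Sum>j\<in>E. (Df z i \<bullet> D2f z w j) * a z i j) + (\<Sum>i\<in>E. \<Sum>j\<in>E. (D2f z w i \<bullet> Df z j) * a z i j)"
    by (simp add: G'_def distrib_right sum.distrib)
  \<comment> \<open>The two halves of \<open>G'\<close> contribute the same sum, by symmetry of the
    second fundamental form; one copy cancels against the first half of \<open>a'\<close>.\<close>
  also have "(\<Sum>i\<in>E. \<Sum>j\<in>E. (Df z i \<bullet> D2f z w j) * a z i j) = (\<Sum>j\<in>E. \<Sum>i\<in>E. (D2f z w j \<bullet> Df z i) * a z j i)"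
    using weingarten_sym[OF zh] by (subst sum.swap) (simp add: a_def inner_commute)
  also have pars: "(\<Sum>i\<in>E. \<Sum>j\<in>E. (D2f z w i \<bullet> Df z j) * a z i j) = (\<Sum>i\<in>E. Dg z i \<bullet> D2f z w i)"
  proof (intro sum.cong refl)
    fix i
    have "Dg z i \<in> range (Df z)" using tangent_range[OF zh normal_deriv[OF zh]] by (metis rangeI)
    from frame_parseval[OF lin E this, of "D2f z w i"]
    show "(\<Sum>j\<in>E. (D2f z w i \<bullet> Df z j) * a z i j) = Dg z i \<bullet> D2f z w i"
      by (simp add: a_def mult.commute)
  qed
  finally show ?thesis by (simp add: a'_def sum.distrib)
qed

text \<open>The equation \<Delta>N = -|A|^2 N in a chart: since \<Delta>F = 0, the vector
  \<open>X\<close> is the first-order correction between the frame sum of second derivatives and the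
  Laplacian. The normal component comes from \<open>normal_deriv2\<close> and Parseval. The
  remainder \<open>Y\<close> is therefore tangent, and it is orthogonal to itself by the traced
  Codazzi equation.\<close>

lemma laplace_normal:
  assumes z: "z \<in> U" "0 < z \<bullet> inward_dir" and E: "frame (Df z) E" and tr: "(\<Sum>e\<in>E. D2f z e e \<bullet> g z) = 0"
    and X: "Df z X = (\<Sum>e\<in>E. D2f z e e)"
  shows "(\<Sum>e\<in>E. D2g z e e) = Dg z X - (\<Sum>b\<in>E. \<Sum>c\<in>E. (D2f z b c \<bullet> g z)\<^sup>2) *\<^sub>R g z"
proof -
  have zh: "z \<in> U \<inter> half_space" using z by (auto simp: half_space_def)
  have lin: "linear (Df z)" using f_linear z by blast
  define \<alpha> where "\<alpha> = (\<Sum>b\<in>E. \<Sum>c\<in>E. (D2f z b c \<bullet> g z)\<^sup>2)"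
  define Y where "Y = (\<Sum>e\<in>E. D2g z e e) - Dg z X + \<alpha> *\<^sub>R g z"
  have "(\<Sum>e\<in>E. D2g z e e) \<bullet> g z = - \<alpha>"
  proof -
    have "Dg z e \<bullet> Dg z e = (\<Sum>c\<in>E. (D2f z e c \<bullet> g z)\<^sup>2)" for e
    proof -
      have "Dg z e \<in> range (Df z)" using tangent_range[OF zh normal_deriv[OF zh]] by (metis rangeI)
      from frame_parseval[OF lin E this, of "Dg z e"] show ?thesis
        by (simp add: weingarten[OF zh] power2_eq_square)
    qed
    then show ?thesis by (simp add: inner_sum_left normal_deriv2[OF zh] \<alpha>_def sum_negf)
  qed
  then have "Y \<bullet> g z = 0"
    by (simp add: Y_def inner_add_left inner_diff_left normal_deriv[OF zh] unit[OF zh])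
  then obtain w where w: "Df z w = Y" using tangent_range[OF zh] by blast
  have symf: "D2f z u v = D2f z v u" and symg: "D2g z u v = D2g z v u" for u v
    using symmetric_second_derivative[OF f_jet z(1)] symmetric_second_derivative[OF g_jet z(1)] by auto
  \<comment> \<open>Symmetry of \<open>D2g\<close> moves \<open>w\<close> into the first slot, the
    form in which \<open>trace_codazzi\<close> applies.\<close>
  have "(\<Sum>e\<in>E. D2g z e e) \<bullet> Df z w = (\<Sum>e\<in>E. D2g z w e \<bullet> Df z e - Dg z e \<bullet> D2f z w e + Dg z w \<bullet> D2f z e e)"
    unfolding inner_sum_left
  proof (rule sum.cong[OF refl])
    fix e
    show "D2g z e e \<bullet> Df z w = D2g z w e \<bullet> Df z e - Dg z e \<bullet> D2f z w e + Dg z w \<bullet> D2f z e e"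
      using weingarten_deriv[OF zh, of e e w] symf[of e w] symg[of e w] by simp
  qed
  also have "\<dots> = Dg z w \<bullet> Df z X"
    using trace_codazzi[OF z E tr, of w] by (simp add: sum.distrib sum_subtractf X inner_sum_right)
  also have "\<dots> = Dg z X \<bullet> Df z w" by (rule weingarten_sym[OF zh])
  finally have "Y \<bullet> Df z w = 0"
    using normal[OF zh, of w] by (simp add: Y_def inner_add_left inner_diff_left inner_commute[of "g z"])
  then have "Y = 0" using w by simp
  then show ?thesis by (simp add: Y_def \<alpha>_def algebra_simps)
qed

text \<open>The function \<open>\<phi> = 13 - 14 |x|\<^sup>2 + 2 |x|\<^sup>4\<close> is at least 1 on the ball, and
  \<open>\<Delta>\<phi> + 2 n \<phi> < 0\<close> on a minimal hypersurface. It perturbs \<open>1 - |x|\<^sup>2\<close>, for which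
  the inequality degenerates at the origin and positivity fails on the boundary.\<close>

lemma support_function_no_touching:
  assumes z: "z \<in> U" "0 < z \<bullet> inward_dir" and ball: "f z \<bullet> f z \<le> 1" and c: "0 < c"
    and min: "\<And>y. y \<in> U \<inter> half_space \<Longrightarrow>
      \<sigma> * (f y \<bullet> g y) \<le> c * (13 - 14 * (f y \<bullet> f y) + 2 * ((f y \<bullet> f y) * (f y \<bullet> f y)))"
    and eq: "\<sigma> * (f z \<bullet> g z) = c * (13 - 14 * (f z \<bullet> f z) + 2 * ((f z \<bullet> f z) * (f z \<bullet> f z)))"
  shows False
proof -
  have zh: "z \<in> U \<inter> half_space" using z by (auto simp: half_space_def)
  have lin: "linear (Df z)" using f_linear z by blast
  obtain E where E: "frame (Df z) E" and tr: "(\<Sum>e\<in>E. D2f z e e \<bullet> g z) = 0"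
    and A2: "(\<Sum>b\<in>E. \<Sum>c\<in>E. (D2f z b c \<bullet> g z)\<^sup>2) \<le> 2 * real DIM('d)"
    using curvature[OF zh] by blast
  define \<alpha> where "\<alpha> = (\<Sum>b\<in>E. \<Sum>c\<in>E. (D2f z b c \<bullet> g z)\<^sup>2)"
  define n where "n = real DIM('d)"
  define s where "s = f z \<bullet> f z"
  \<comment> \<open>The gap between the barrier and the multiple \<sigma> of the support function:
    nonnegative, with value 0 at \<open>z\<close>. \<open>V'\<close> and \<open>V2\<close> are its
    first and second derivatives.\<close>
  define V where "V y = c * (13 - 14 * (f y \<bullet> f y) + 2 * ((f y \<bullet> f y) * (f y \<bullet> f y))) - \<sigma> * (f y \<bullet> g y)" for y
  define V' where "V' y w = c * ((4 * (f y \<bullet> f y) - 14) * (2 * (f y \<bullet> Df y w))) -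
    \<sigma> * (f y \<bullet> Dg y w + Df y w \<bullet> g y)" for y w
  define V2 where "V2 w u = c * ((4 * s - 14) * (2 * (f z \<bullet> D2f z u w + Df z u \<bullet> Df z w)) +
      4 * (2 * (f z \<bullet> Df z u)) * (2 * (f z \<bullet> Df z w))) -
    \<sigma> * ((f z \<bullet> D2g z u w + Df z u \<bullet> Dg z w) + (Df z w \<bullet> Dg z u + D2f z u w \<bullet> g z))" for w u
  have dV: "(V has_derivative V' y) (at y)" if "y \<in> U" for y
    unfolding V_def V'_def using df[OF that] dg[OF that]
    by (auto intro!: derivative_eq_intros simp: fun_eq_iff inner_commute algebra_simps)
  have d2V: "((\<lambda>y. V' y w) has_derivative V2 w) (at z)" for w
    unfolding V2_def V'_def s_def using df[OF z(1)] dg[OF z(1)] d2f[OF z(1)] d2g[OF z(1)]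
    by (auto intro!: derivative_eq_intros simp: fun_eq_iff inner_commute algebra_simps)
  have Vmin: "V z \<le> V y" if "y \<in> U \<inter> half_space" for y
    using min[OF that] eq by (simp add: V_def)
  have crit: "V' z w = 0" for w
    by (rule interior_min_deriv_zero[OF dV[OF z(1)] open_U z Vmin])
  have V2_nonneg: "0 \<le> V2 e e" for e
    by (rule interior_min_deriv2_nonneg[OF dV d2V open_U z Vmin])
  have "(\<Sum>e\<in>E. D2f z e e) \<bullet> g z = 0" using tr by (simp add: inner_sum_left)
  then obtain X where X: "Df z X = (\<Sum>e\<in>E. D2f z e e)" using tangent_range[OF zh] by blast
  have DgDf: "Df z e \<bullet> Dg z e = - (D2f z e e \<bullet> g z)" for e
    using weingarten[OF zh, of e e] by (simp add: inner_commute)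
  define t where "t = (\<Sum>e\<in>E. (f z \<bullet> Df z e)\<^sup>2)"
  have t: "t \<le> s" unfolding t_def s_def by (rule frame_bessel[OF lin E])
  have cardE: "real (card E) = n" using frame_card[OF lin E] by (simp add: n_def)
  have "V2 e e = c * ((4 * s - 14) * (2 * (f z \<bullet> D2f z e e + 1)) + 16 * (f z \<bullet> Df z e)\<^sup>2) -
      \<sigma> * (f z \<bullet> D2g z e e) + \<sigma> * (D2f z e e \<bullet> g z)" if "e \<in> E" for e
  proof -
    have "Df z e \<bullet> Df z e = 1" using E that by (simp add: frame_def)
    then show ?thesis unfolding V2_def DgDf by (simp add: power2_eq_square algebra_simps)
  qed
  then have "(\<Sum>e\<in>E. V2 e e) = (\<Sum>e\<in>E. c * ((4 * s - 14) * (2 * (f z \<bullet> D2f z e e + 1)) + 16 * (f z \<bullet> Df z e)\<^sup>2) -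
      \<sigma> * (f z \<bullet> D2g z e e) + \<sigma> * (D2f z e e \<bullet> g z))" by simp
  also have "\<dots> = c * ((4 * s - 14) * (2 * (f z \<bullet> (\<Sum>e\<in>E. D2f z e e) + n)) + 16 * t) -
      \<sigma> * (f z \<bullet> (\<Sum>e\<in>E. D2g z e e)) + \<sigma> * (\<Sum>e\<in>E. D2f z e e \<bullet> g z)"
    unfolding t_def cardE[symmetric]
    by (simp add: sum.distrib sum_subtractf sum_distrib_left[symmetric] inner_sum_right)
  also have "\<dots> = c * ((4 * s - 14) * (2 * (f z \<bullet> Df z X + n)) + 16 * t) -
      \<sigma> * (f z \<bullet> Dg z X) + \<alpha> * (\<sigma> * (f z \<bullet> g z))"
    unfolding laplace_normal[OF z E tr X] tr X[symmetric] \<alpha>_def[symmetric]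
    by (simp add: inner_diff_right algebra_simps)
  \<comment> \<open>All terms containing \<open>X\<close> add up to \<open>V' z X\<close>, which is
    0 at the critical point; \<open>eq\<close> turns the support function into the barrier.\<close>
  also have "\<dots> = c * ((4 * s - 14) * (2 * n) + 16 * t + \<alpha> * (13 - 14 * s + 2 * (s * s)))"
    using crit[of X] normal[OF zh, of X] unfolding eq V'_def s_def[symmetric] by (simp add: algebra_simps)
  finally have sum_eq: "(\<Sum>e\<in>E. V2 e e) = c * ((4 * s - 14) * (2 * n) + 16 * t + \<alpha> * (13 - 14 * s + 2 * (s * s)))" .
  have s01: "0 \<le> s" "s \<le> 1" using ball by (auto simp: s_def)
  have n1: "1 \<le> n" unfolding n_def using DIM_ge_Suc0[where 'a='d] by simp
  \<comment> \<open>The barrier is 1 + 10 (1 - s) + 2 (1 - s)^2: the constant makes it positive at s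
    = 1, and the square makes its slope -14 at s = 0 exceed its value 13 there in size.\<close>
  have "0 \<le> 2 * ((1 - s) * (1 - s))" using s01 by simp
  then have "0 \<le> 13 - 14 * s + 2 * (s * s)" using s01 by (simp add: algebra_simps)
  then have "\<alpha> * (13 - 14 * s + 2 * (s * s)) \<le> 2 * n * (13 - 14 * s + 2 * (s * s))"
    using A2 unfolding \<alpha>_def[symmetric] n_def by (intro mult_right_mono)
  \<comment> \<open>The term -20 n s absorbs both 16 s and 4 n s^2, because n >= 1 and s <= 1; at
    most -2n remains.\<close>
  moreover have "(4 * s - 14) * (2 * n) + 16 * s + 2 * n * (13 - 14 * s + 2 * (s * s)) < 0"
  proof -
    have "s \<le> n * s" using n1 s01 by (simp add: mult_le_cancel_right1)
    moreover have "n * (s * s) \<le> n * s" using n1 s01 by (intro mult_left_mono) (auto simp: mult_left_le)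
    moreover have "0 \<le> n * s" using n1 s01 by simp
    moreover have "(4 * s - 14) * (2 * n) + 16 * s + 2 * n * (13 - 14 * s + 2 * (s * s)) =
        16 * s - 2 * n - 20 * (n * s) + 4 * (n * (s * s))" by (simp add: algebra_simps)
    ultimately show ?thesis using n1 by linarith
  qed
  ultimately have "(4 * s - 14) * (2 * n) + 16 * t + \<alpha> * (13 - 14 * s + 2 * (s * s)) < 0"
    using t by linarith
  then have "(\<Sum>e\<in>E. V2 e e) < 0" unfolding sum_eq using c by (simp add: mult_pos_neg)
  moreover have "0 \<le> (\<Sum>e\<in>E. V2 e e)" using V2_nonneg by (intro sum_nonneg)
  ultimately show False by simp
qed

end

section \<open>Local homeomorphisms onto convex sets\<close>

text \<open>The set where the lifts agree is closed because the space is Hausdorff, and open because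
  \<open>F\<close> is injective near a common value.\<close>

lemma lift_unique:
  fixes F :: "'m::t2_space \<Rightarrow> 'e" and \<alpha> \<beta> :: "'x::topological_space \<Rightarrow> 'm"
  assumes inj: "\<And>p. p \<in> M \<Longrightarrow> \<exists>W. openin (top_of_set M) W \<and> p \<in> W \<and> inj_on F W"
    and \<alpha>: "continuous_on X \<alpha>" "\<alpha> \<in> X \<rightarrow> M" and \<beta>: "continuous_on X \<beta>" "\<beta> \<in> X \<rightarrow> M"
    and eq: "\<And>x. x \<in> X \<Longrightarrow> F (\<alpha> x) = F (\<beta> x)"
    and X: "connected X" "x0 \<in> X" "\<alpha> x0 = \<beta> x0" and x: "x \<in> X"
  shows "\<alpha> x = \<beta> x"
proof -
  have haus: "Hausdorff_space (euclidean :: 'm topology)"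
    unfolding Hausdorff_space_def disjnt_def by (auto dest!: hausdorff)
  define S where "S = {x \<in> X. \<alpha> x = \<beta> x}"
  have "closedin (top_of_set X) {x \<in> topspace (top_of_set X). \<alpha> x = \<beta> x}"
    by (rule closedin_continuous_maps_eq[where Y=euclidean]) (use haus \<alpha> \<beta> in auto)
  then have closed: "closedin (top_of_set X) S" by (simp add: S_def)
  have "openin (top_of_set X) S"
  proof (subst openin_subopen, intro ballI)
    fix y assume y: "y \<in> S"
    then have "y \<in> X" "\<alpha> y = \<beta> y" by (auto simp: S_def)
    then obtain W where W: "openin (top_of_set M) W" "\<alpha> y \<in> W" "inj_on F W"
      using inj[of "\<alpha> y"] \<alpha> by blast
    have "openin (top_of_set X) ((X \<inter> \<alpha> -` W) \<inter> (X \<inter> \<beta> -` W))"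
      using continuous_openin_preimage[OF \<alpha> W(1)] continuous_openin_preimage[OF \<beta> W(1)] by (rule openin_Int)
    moreover have "(X \<inter> \<alpha> -` W) \<inter> (X \<inter> \<beta> -` W) \<subseteq> S"
      using W(3) eq by (auto simp: S_def inj_on_def)
    ultimately show "\<exists>T. openin (top_of_set X) T \<and> y \<in> T \<and> T \<subseteq> S"
      using \<open>y \<in> X\<close> \<open>\<alpha> y = \<beta> y\<close> W(2) by (intro exI[of _ "(X \<inter> \<alpha> -` W) \<inter> (X \<inter> \<beta> -` W)"]) auto
  qed
  with closed X have "S = X"
    unfolding connected_clopen S_def by blast
  then show ?thesis using x by (auto simp: S_def)
qed

text \<open>A Lebesgue number argument: compactness yields one radius \<delta> such that every point
  \<open>q\<close> has a section \<open>S q\<close> of \<open>F\<close> through \<open>q\<close> on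
  the whole of \<open>D \<inter> ball (F q) \<delta>\<close>, borrowed from a nearby centre
  \<open>c q\<close>.\<close>

lemma uniform_sheets:
  fixes F :: "'m::t2_space \<Rightarrow> 'e::euclidean_space"
  assumes M: "compact M" and F: "continuous_on M F"
    and loc: "\<And>p. p \<in> M \<Longrightarrow> \<exists>W r g. openin (top_of_set M) W \<and> p \<in> W \<and> 0 < r \<and>
      homeomorphism W (D \<inter> ball (F p) r) F g"
  shows "\<exists>\<delta> S. 0 < \<delta> \<and> (\<forall>q\<in>M. continuous_on (D \<inter> ball (F q) \<delta>) (S q) \<and>
      S q \<in> D \<inter> ball (F q) \<delta> \<rightarrow> M \<and> (\<forall>z \<in> D \<inter> ball (F q) \<delta>. F (S q z) = z) \<and> S q (F q) = q \<and>
      openin (top_of_set M) (S q ` (D \<inter> ball (F q) \<delta>)))"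
proof -
  from loc obtain W r g where W: "\<And>p. p \<in> M \<Longrightarrow> openin (top_of_set M) (W p)" "\<And>p. p \<in> M \<Longrightarrow> p \<in> W p"
    and r: "\<And>p. p \<in> M \<Longrightarrow> 0 < r p" and g: "\<And>p. p \<in> M \<Longrightarrow> homeomorphism (W p) (D \<inter> ball (F p) (r p)) F (g p)"
    by metis
  \<comment> \<open>Half the radius is reserved for the displacement from the centre
    \<open>p\<close> to the point \<open>q\<close>, the other half for the ball around
    \<open>F q\<close>.\<close>
  define W' where "W' p = W p \<inter> (M \<inter> F -` ball (F p) (r p / 2))" for p
  have W': "openin (top_of_set M) (W' p)" if "p \<in> M" for p
    unfolding W'_def using W(1)[OF that] continuous_openin_preimage_gen[OF F open_ball] by (rule openin_Int)
  have "p \<in> W' p" if "p \<in> M" for p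
    using W(2) r that by (auto simp: W'_def)
  then have cover: "M \<subseteq> (\<Union>p\<in>M. W' p)" by blast
  obtain P where P: "P \<subseteq> M" "finite P" "M \<subseteq> (\<Union>p\<in>P. W' p)"
  proof -
    obtain O' where O': "\<And>p. p \<in> M \<Longrightarrow> open (O' p)" "\<And>p. p \<in> M \<Longrightarrow> W' p = M \<inter> O' p"
      using W' unfolding openin_open by metis
    have "M \<subseteq> (\<Union>p\<in>M. O' p)" using cover O'(2) by blast
    from compactE_image[OF M _ this] O'(1) obtain C where "C \<subseteq> M" "finite C" "M \<subseteq> (\<Union>p\<in>C. O' p)" by metis
    then show ?thesis using that[of C] O'(2) by blast
  qed
  define \<delta> where "\<delta> = Min (insert 1 ((\<lambda>p. r p / 2) ` P))"
  have \<delta>: "0 < \<delta>" "\<And>p. p \<in> P \<Longrightarrow> \<delta> \<le> r p / 2"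
  proof -
    show "0 < \<delta>" using P r by (auto simp: \<delta>_def subset_iff)
    show "\<delta> \<le> r p / 2" if "p \<in> P" for p
      unfolding \<delta>_def using P(2) that by (intro Min_le) auto
  qed
  from P(3) obtain c where c: "\<And>q. q \<in> M \<Longrightarrow> c q \<in> P" "\<And>q. q \<in> M \<Longrightarrow> q \<in> W' (c q)"
    by (metis UN_E subsetD)
  have cM: "c q \<in> M" if "q \<in> M" for q using c(1) P(1) that by blast
  have sub: "ball (F q) \<delta> \<subseteq> ball (F (c q)) (r (c q))" if "q \<in> M" for q
  proof
    fix z assume z: "z \<in> ball (F q) \<delta>"
    have "dist (F (c q)) (F q) < r (c q) / 2" using c(2)[OF that] by (auto simp: W'_def)
    moreover have "dist (F q) z < r (c q) / 2" using z \<delta>(2)[OF c(1)[OF that]] by simp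
    ultimately have "dist (F (c q)) z < r (c q)"
      using dist_triangle[of "F (c q)" z "F q"] by linarith
    then show "z \<in> ball (F (c q)) (r (c q))" by simp
  qed
  define S where "S q = g (c q)" for q
  note h = g[OF cM, folded S_def]
  show ?thesis
  proof (intro exI[of _ \<delta>] exI[of _ S] conjI[OF \<delta>(1)] ballI)
    fix q assume q: "q \<in> M"
    have subD: "D \<inter> ball (F q) \<delta> \<subseteq> D \<inter> ball (F (c q)) (r (c q))" using sub[OF q] by blast
    have 1: "continuous_on (D \<inter> ball (F q) \<delta>) (S q)"
      using homeomorphism_cont2[OF h[OF q]] subD by (rule continuous_on_subset)
    have WM: "W (c q) \<subseteq> M" using W(1)[OF cM[OF q]] openin_imp_subset by blast
    have SW: "S q z \<in> W (c q)" if "z \<in> D \<inter> ball (F q) \<delta>" for z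
      using homeomorphism_image2[OF h[OF q]] subD that by blast
    then have 2: "S q \<in> D \<inter> ball (F q) \<delta> \<rightarrow> M" using WM by blast
    have FS: "F (S q z) = z" if "z \<in> D \<inter> ball (F q) \<delta>" for z
      using homeomorphism_apply2[OF h[OF q]] subD that by blast
    have qW: "q \<in> W (c q)" using c(2)[OF q] by (simp add: W'_def)
    then have 3: "S q (F q) = q"
      using homeomorphism_apply1[OF h[OF q]] by blast
    have "S q ` (D \<inter> ball (F q) \<delta>) = W (c q) \<inter> (M \<inter> F -` ball (F q) \<delta>)"
    proof (intro equalityI subsetI)
      fix x assume "x \<in> S q ` (D \<inter> ball (F q) \<delta>)"
      then show "x \<in> W (c q) \<inter> (M \<inter> F -` ball (F q) \<delta>)"
        using SW FS WM by fastforce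
    next
      fix x assume x: "x \<in> W (c q) \<inter> (M \<inter> F -` ball (F q) \<delta>)"
      then have "S q (F x) = x" "F x \<in> D \<inter> ball (F q) \<delta>"
        using homeomorphism_apply1[OF h[OF q]] homeomorphism_image1[OF h[OF q]] by blast+
      then show "x \<in> S q ` (D \<inter> ball (F q) \<delta>)" by force
    qed
    then have 4: "openin (top_of_set M) (S q ` (D \<inter> ball (F q) \<delta>))"
      using W(1)[OF cM[OF q]] continuous_openin_preimage_gen[OF F open_ball] by (auto intro: openin_Int)
    from 1 2 FS 3 4 show "continuous_on (D \<inter> ball (F q) \<delta>) (S q) \<and>
      S q \<in> D \<inter> ball (F q) \<delta> \<rightarrow> M \<and> (\<forall>z \<in> D \<inter> ball (F q) \<delta>. F (S q z) = z) \<and> S q (F q) = q \<and>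
      openin (top_of_set M) (S q ` (D \<inter> ball (F q) \<delta>))" by blast
  qed
qed

text \<open>A local homeomorphism of a compact space has unique lifting of segments. The points reachable from
  \<open>p\<close> along lifted segments form a clopen set, and a point in the fibre of \<open>p\<close> is reached only along
  the constant segment.\<close>

lemma local_homeomorphism_onto_convex_inj:
  fixes F :: "'m::t2_space \<Rightarrow> 'e::euclidean_space"
  assumes M: "compact M" "connected M" and F: "continuous_on M F" and D: "convex D" "F ` M \<subseteq> D"
    and loc: "\<And>p. p \<in> M \<Longrightarrow> \<exists>W r g. openin (top_of_set M) W \<and> p \<in> W \<and> 0 < r \<and>
      homeomorphism W (D \<inter> ball (F p) r) F g"
  shows "inj_on F M"
proof -
  have inj: "\<exists>W. openin (top_of_set M) W \<and> p \<in> W \<and> inj_on F W" if "p \<in> M" for p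
    using loc[OF that] by (metis homeomorphism_apply1 inj_on_def)
  obtain \<delta> S where \<delta>: "0 < \<delta>"
    and S: "\<forall>q\<in>M. continuous_on (D \<inter> ball (F q) \<delta>) (S q) \<and>
      S q \<in> D \<inter> ball (F q) \<delta> \<rightarrow> M \<and> (\<forall>z \<in> D \<inter> ball (F q) \<delta>. F (S q z) = z) \<and> S q (F q) = q \<and>
      openin (top_of_set M) (S q ` (D \<inter> ball (F q) \<delta>))"
    using uniform_sheets[OF M(1) F loc] by blast
  have S_cont: "continuous_on (D \<inter> ball (F q) \<delta>) (S q)"
    and S_M: "S q \<in> D \<inter> ball (F q) \<delta> \<rightarrow> M"
    and S_F: "S q (F q) = q"
    and S_open: "openin (top_of_set M) (S q ` (D \<inter> ball (F q) \<delta>))" if "q \<in> M" for q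
    using S that by blast+
  have F_S: "F (S q z) = z" if "q \<in> M" "z \<in> D \<inter> ball (F q) \<delta>" for q z
    using S that by blast
  have FD: "F q \<in> D" if "q \<in> M" for q using D(2) that by blast
  \<comment> \<open>The domain common to both sections is an intersection of convex sets, hence
    connected, and the sections agree at \<open>F q'\<close>.\<close>
  have S_agree: "S q z = S q' z" if q: "q \<in> M" "q' \<in> M" and near: "F q' \<in> ball (F q) \<delta>" "S q (F q') = q'"
    and z: "z \<in> D" "z \<in> ball (F q) \<delta>" "z \<in> ball (F q') \<delta>" for q q' z
  proof (rule lift_unique[where X="D \<inter> ball (F q) \<delta> \<inter> ball (F q') \<delta>" and \<alpha>="S q" and \<beta>="S q'" and F=F and M=M and ?x0.0="F q'"])
    show "connected (D \<inter> ball (F q) \<delta> \<inter> ball (F q') \<delta>)"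
      using D(1) by (intro convex_connected convex_Int convex_ball)
    show "continuous_on (D \<inter> ball (F q) \<delta> \<inter> ball (F q') \<delta>) (S q)" "continuous_on (D \<inter> ball (F q) \<delta> \<inter> ball (F q') \<delta>) (S q')"
      using S_cont q by (auto intro: continuous_on_subset)
    show "S q (F q') = S q' (F q')" using near S_F q by simp
  qed (use inj q S_M F_S z near \<delta> FD S_F in auto)
  define seg where "seg a b t = (1 - t) *\<^sub>R a + t *\<^sub>R b" for a b :: 'e and t :: real
  have seg_cont: "continuous_on A (seg a b)" for A a b
    unfolding seg_def by (intro continuous_intros)
  have seg_D: "seg a b t \<in> D" if "a \<in> D" "b \<in> D" "t \<in> {0..1}" for a b t
    using that D(1) unfolding seg_def by (auto intro!: convexD_alt)
  \<comment> \<open>\<open>L p q\<close>: the segment from \<open>F p\<close> to \<open>F q\<close>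
    lifts to a path from \<open>p\<close> to \<open>q\<close>.\<close>
  define L where "L p q \<longleftrightarrow> (\<exists>\<gamma>. continuous_on {0..1} \<gamma> \<and> \<gamma> \<in> {0..1} \<rightarrow> M \<and> \<gamma> 0 = p \<and> \<gamma> 1 = q \<and>
    (\<forall>t\<in>{0..1}. F (\<gamma> t) = seg (F p) (F q) t))" for p q
  have step: "L p q'" if pq: "p \<in> M" "L p q" and q': "q' \<in> S q ` (D \<inter> ball (F q) \<delta>)" for p q q'
  proof -
    obtain \<gamma> where \<gamma>: "continuous_on {0..1} \<gamma>" "\<gamma> \<in> {0..1} \<rightarrow> M" "\<gamma> 0 = p" "\<gamma> 1 = q"
      and F\<gamma>: "\<And>t. t \<in> {0..1} \<Longrightarrow> F (\<gamma> t) = seg (F p) (F q) t"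
      using pq(2) unfolding L_def by blast
    have q: "q \<in> M" using \<gamma> by force
    have q'M: "q' \<in> M" and Fq': "F q' \<in> ball (F q) \<delta>" "S q (F q') = q'"
      using q' S_M[OF q] F_S[OF q] by auto
    define c where "c = seg (F p) (F q)"
    define c' where "c' = seg (F p) (F q')"
    have cont: "continuous_on A c" "continuous_on A c'" for A
      unfolding c_def c'_def by (rule seg_cont)+
    have cD: "c t \<in> D" "c' t \<in> D" if "t \<in> {0..1}" for t
      unfolding c_def c'_def using that FD pq(1) q q'M by (auto intro!: seg_D)
    have near: "c' t \<in> ball (c t) \<delta>" if "t \<in> {0..1}" for t
    proof -
      have "c t - c' t = t *\<^sub>R (F q - F q')"
        by (simp add: c_def c'_def seg_def algebra_simps)
      then have "dist (c t) (c' t) = t * dist (F q) (F q')"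
        using that by (simp add: dist_norm)
      also have "\<dots> \<le> dist (F q) (F q')" using that by (simp add: mult_left_le_one_le)
      finally show ?thesis using Fq' by simp
    qed
    \<comment> \<open>The new segment stays within \<delta> of the old one at equal times, so it is
      lifted by using, at time \<open>t\<close>, the sheet through the old lift
      \<open>\<gamma> t\<close>.\<close>
    define \<gamma>' where "\<gamma>' t = S (\<gamma> t) (c' t)" for t
    have F\<gamma>c: "F (\<gamma> t) = c t" "\<gamma> t \<in> M" if "t \<in> {0..1}" for t
      using F\<gamma> \<gamma>(2) that by (auto simp: c_def)
    have "continuous (at t0 within {0..1}) \<gamma>'" if t0: "t0 \<in> {0..1}" for t0
    proof -
      have "isCont c t0" "isCont c' t0"
        using cont continuous_on_eq_continuous_at by blast+
      then have lim: "(c \<longlongrightarrow> c t0) (nhds t0)" "(c' \<longlongrightarrow> c' t0) (nhds t0)"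
        unfolding continuous_at tendsto_at_iff_tendsto_nhds by blast+
      have "eventually (\<lambda>t. c t \<in> ball (c t0) \<delta> \<and> c' t \<in> ball (c t0) \<delta>) (nhds t0)"
        using topological_tendstoD[OF lim(1) open_ball[of "c t0" \<delta>]]
          topological_tendstoD[OF lim(2) open_ball[of "c t0" \<delta>]] near[OF t0] \<delta>
        by (simp add: eventually_conj)
      then obtain \<eta> where \<eta>: "\<eta> > 0" "\<And>t. dist t t0 < \<eta> \<Longrightarrow> c t \<in> ball (c t0) \<delta> \<and> c' t \<in> ball (c t0) \<delta>"
        unfolding eventually_nhds_metric by blast
      define T where "T = {0..1} \<inter> ball t0 \<eta>"
      have T: "connected T" unfolding T_def by (intro convex_connected convex_Int convex_ball) auto
      have t0T: "t0 \<in> T" using t0 \<eta> by (simp add: T_def)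
      have sub: "c ` T \<subseteq> D \<inter> ball (F (\<gamma> t0)) \<delta>" "c' ` T \<subseteq> D \<inter> ball (F (\<gamma> t0)) \<delta>"
        using cD \<eta>(2) F\<gamma>c t0 by (auto simp: T_def dist_commute)
      have \<gamma>S: "S (\<gamma> t0) (c t) = \<gamma> t" if "t \<in> T" for t
      proof (rule lift_unique[where X=T and \<alpha>="\<lambda>t. S (\<gamma> t0) (c t)" and \<beta>=\<gamma> and F=F and M=M and ?x0.0=t0])
        show "continuous_on T (\<lambda>t. S (\<gamma> t0) (c t))"
          using sub by (intro continuous_on_compose2[OF S_cont[OF F\<gamma>c(2)[OF t0]] cont(1)])
        show "S (\<gamma> t0) (c t0) = \<gamma> t0"
          using S_F[OF F\<gamma>c(2)[OF t0]] F\<gamma>c(1)[OF t0] by simp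
        show "continuous_on T \<gamma>" using \<gamma>(1) by (rule continuous_on_subset) (simp add: T_def)
        show "\<gamma> \<in> T \<rightarrow> M" using \<gamma>(2) by (auto simp: T_def)
        show "(\<lambda>t. S (\<gamma> t0) (c t)) \<in> T \<rightarrow> M" using S_M[OF F\<gamma>c(2)[OF t0]] sub by blast
        show "F (S (\<gamma> t0) (c t)) = F (\<gamma> t)" if "t \<in> T" for t
          using F_S[OF F\<gamma>c(2)[OF t0], of "c t"] sub(1) F\<gamma>c(1)[of t] that by (auto simp: T_def image_subset_iff)
      qed (use inj T t0T that in auto)
      \<comment> \<open>Near \<open>t0\<close> the varying sheet may be replaced by the fixed sheet
        at \<open>\<gamma> t0\<close>, which makes continuity evident.\<close>
      have eq: "\<gamma>' t = S (\<gamma> t0) (c' t)" if "t \<in> T" for t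
      proof -
        have t: "t \<in> {0..1}" using that by (simp add: T_def)
        show ?thesis
          unfolding \<gamma>'_def using sub that near[OF t] F\<gamma>c t0 t \<gamma>S[OF that]
          by (intro S_agree[symmetric]) auto
      qed
      have "continuous_on T (\<lambda>t. S (\<gamma> t0) (c' t))"
        using sub by (intro continuous_on_compose2[OF S_cont[OF F\<gamma>c(2)[OF t0]] cont(2)])
      then have "continuous_on T \<gamma>'" using eq by (simp cong: continuous_on_cong)
      then have "continuous (at t0 within T) \<gamma>'"
        using t0T continuous_on_eq_continuous_within by blast
      moreover have "at t0 within T = at t0 within {0..1}"
        unfolding T_def using \<eta>(1) by (intro at_within_nhd[of t0 "ball t0 \<eta>"]) auto
      ultimately show ?thesis by simp
    qed
    then have "continuous_on {0..1} \<gamma>'"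
      by (simp add: continuous_on_eq_continuous_within)
    moreover have "\<gamma>' \<in> {0..1} \<rightarrow> M"
    proof
      fix t :: real assume t: "t \<in> {0..1}"
      then show "\<gamma>' t \<in> M" unfolding \<gamma>'_def using S_M[OF F\<gamma>c(2)[OF t]] F\<gamma>c(1)[OF t] near[OF t] cD[OF t] by auto
    qed
    moreover have "F (\<gamma>' t) = c' t" if t: "t \<in> {0..1}" for t
      unfolding \<gamma>'_def using F_S[OF F\<gamma>c(2)[OF t]] F\<gamma>c(1)[OF t] near[OF t] cD[OF t] by auto
    moreover have "\<gamma>' 0 = p" "\<gamma>' 1 = q'"
      using \<gamma> S_F[OF pq(1)] Fq' by (auto simp: \<gamma>'_def c'_def seg_def)
    ultimately show ?thesis unfolding L_def c'_def by blast
  qed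
  show ?thesis
  proof (rule inj_onI)
    fix p q assume pq: "p \<in> M" "q \<in> M" "F p = F q"
    define Q where "Q = {q \<in> M. L p q}"
    have "L p p" unfolding L_def using pq(1) by (intro exI[of _ "\<lambda>t. p"]) (auto simp: seg_def algebra_simps)
    then have "p \<in> Q" using pq by (simp add: Q_def)
    have mem: "q \<in> S q ` (D \<inter> ball (F q) \<delta>)" if "q \<in> M" for q
      using S_F[OF that] FD[OF that] \<delta> by (intro image_eqI[of _ _ "F q"]) auto
    have sheet_M: "S q ` (D \<inter> ball (F q) \<delta>) \<subseteq> M" if "q \<in> M" for q
      using S_M[OF that] by blast
    have "openin (top_of_set M) Q"
    proof (subst openin_subopen, intro ballI)
      fix x assume "x \<in> Q"
      then have x: "x \<in> M" "L p x" by (auto simp: Q_def)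
      have "S x ` (D \<inter> ball (F x) \<delta>) \<subseteq> Q"
        using step[OF pq(1) x(2)] sheet_M[OF x(1)] unfolding Q_def by blast
      then show "\<exists>T. openin (top_of_set M) T \<and> x \<in> T \<and> T \<subseteq> Q"
        using S_open[OF x(1)] mem[OF x(1)] by blast
    qed
    moreover have "openin (top_of_set M) (M - Q)"
    proof (subst openin_subopen, intro ballI)
      fix x assume x: "x \<in> M - Q"
      have "y \<notin> Q" if y: "y \<in> S x ` (D \<inter> ball (F x) \<delta>)" for y
      proof
        assume "y \<in> Q"
        then have yM: "y \<in> M" "L p y" by (auto simp: Q_def)
        have Fy: "F y \<in> D \<inter> ball (F x) \<delta>" "S x (F y) = y" using y x F_S by auto
        \<comment> \<open>Lying in each other's sheet is a symmetric relation, so a reachable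
          \<open>y\<close> in the sheet of \<open>x\<close> would make \<open>x\<close>
          reachable.\<close>
        have "S y (F x) = x"
          using S_agree[of x y "F x"] x yM Fy \<delta> FD S_F by (auto simp: dist_commute)
        then have "x \<in> S y ` (D \<inter> ball (F y) \<delta>)"
          using Fy FD x by (intro image_eqI[of _ _ "F x"]) (auto simp: dist_commute)
        then have "x \<in> Q" using step[OF pq(1) yM(2)] x by (auto simp: Q_def)
        then show False using x by simp
      qed
      then show "\<exists>T. openin (top_of_set M) T \<and> x \<in> T \<and> T \<subseteq> M - Q"
        using mem S_open sheet_M x by (intro exI[of _ "S x ` (D \<inter> ball (F x) \<delta>)"]) blast
    qed
    then have "closedin (top_of_set M) Q" by (simp add: closedin_def Q_def)
    ultimately have "Q = M"
      using M(2) \<open>p \<in> Q\<close> unfolding connected_clopen by blast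
    then have "L p q" using pq by (auto simp: Q_def)
    then obtain \<gamma> where \<gamma>: "continuous_on {0..1} \<gamma>" "\<gamma> \<in> {0..1} \<rightarrow> M" "\<gamma> 0 = p" "\<gamma> 1 = q"
      "\<And>t. t \<in> {0..1} \<Longrightarrow> F (\<gamma> t) = seg (F p) (F q) t"
      unfolding L_def by blast
    \<comment> \<open>As F p = F q, the segment is constant and its lift must be the constant
      path.\<close>
    have "\<gamma> 1 = p"
      by (rule lift_unique[where X="{0..1}" and \<alpha>=\<gamma> and \<beta>="\<lambda>t. p" and F=F and M=M and ?x0.0="0::real"])
         (use inj \<gamma> pq in \<open>auto simp: seg_def algebra_simps\<close>)
    then show "p = q" using \<gamma>(4) by simp
  qed
qed

section \<open>Charts\<close>

lemma inward_dir_Basis: "inward_dir \<in> Basis"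
  unfolding inward_dir_def by (rule someI_ex) (use nonempty_Basis in blast)

lemma closed_half_space: "closed half_space"
  unfolding half_space_def by (intro closed_Collect_le continuous_intros)

text \<open>As \<open>inward_dir\<close> is itself a basis vector, a positive step along any basis
  vector stays in the half-space, and such steps determine the derivative.\<close>

lemma half_space_derivative_unique:
  fixes f :: "'d::euclidean_space \<Rightarrow> 'b::real_normed_vector"
  assumes f: "(f has_derivative f') (at z within S)" "(f has_derivative f'') (at z within S)"
    and U: "open U" "z \<in> U" and z: "z \<in> half_space" and S: "U \<inter> half_space \<subseteq> S"
  shows "f' = f''"
proof (rule frechet_derivative_unique_within[OF f])
  fix i :: 'd and e :: real assume i: "i \<in> Basis" and e: "e > 0"
  obtain r where r: "r > 0" "ball z r \<subseteq> U" using U open_contains_ball by blast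
  define d where "d = min e r / 2"
  have d: "0 < d" "d < e" "d < r" using e r by (auto simp: d_def)
  have "z + d *\<^sub>R i \<in> ball z r" using d i by (simp add: dist_norm)
  moreover have "0 \<le> i \<bullet> inward_dir" using i inward_dir_Basis[where 'a='d] by (simp add: inner_Basis)
  then have "z + d *\<^sub>R i \<in> half_space"
    using z d by (simp add: half_space_def inner_add_left)
  ultimately have "z + d *\<^sub>R i \<in> S" using r S by blast
  then show "\<exists>d. 0 < \<bar>d\<bar> \<and> \<bar>d\<bar> < e \<and> z + d *\<^sub>R i \<in> S" using d by (intro exI[of _ d]) auto
qed

text \<open>Replaces the derivative within the chart image by the ordinary derivative of any local
  extension \<open>G\<close>.\<close>

lemma chart_deriv_eq:
  assumes c: "is_chart M c" and U: "open U" "U \<inter> half_space \<subseteq> chart_image c" and z: "z \<in> U \<inter> half_space"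
    and G: "\<And>y. y \<in> U \<inter> half_space \<Longrightarrow> G y = F (chart_inv c y)" and dG: "(G has_derivative G') (at z)"
  shows "chart_deriv c F (chart_inv c z) = G'"
proof -
  have img: "chart_image c \<subseteq> half_space"
    using c openin_imp_subset unfolding is_chart_def by blast
  have hom: "homeomorphism (fst c) (chart_image c) (snd c) (chart_inv c)"
    using c by (simp add: is_chart_def)
  obtain r where r: "r > 0" "ball z r \<subseteq> U" using U z open_contains_ball by blast
  have "(in_chart c F has_derivative G') (at z within chart_image c)"
  proof (rule has_derivative_transform_within[OF has_derivative_at_withinI[OF dG] r(1)])
    show "z \<in> chart_image c" using U z by blast
    fix y assume "y \<in> chart_image c" "dist y z < r"
    then have "y \<in> U \<inter> half_space" using r(2) img by (auto simp: dist_commute)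
    then show "G y = in_chart c F y" using G by (simp add: in_chart_def)
  qed
  then have "frechet_derivative (in_chart c F) (at z within chart_image c) = G'"
    using half_space_derivative_unique[where U=U] U z frechet_derivative_works differentiableI by blast
  moreover have "snd c (chart_inv c z) = z"
    using homeomorphism_apply2[OF hom] U z by blast
  ultimately show ?thesis by (simp add: chart_deriv_def fun_eq_iff)
qed

lemma Ck_on_subset: "Ck_on k U f \<Longrightarrow> V \<subseteq> U \<Longrightarrow> Ck_on k V f"
  by (induction k arbitrary: f) (auto intro: continuous_on_subset)

definition local_jet ::
  "('m, 'd::euclidean_space) chart \<Rightarrow> ('m \<Rightarrow> 'e::euclidean_space) \<Rightarrow> 'd set \<Rightarrow>
   ('d \<Rightarrow> 'e) \<Rightarrow> ('d \<Rightarrow> 'd \<Rightarrow> 'e) \<Rightarrow> ('d \<Rightarrow> 'd \<Rightarrow> 'd \<Rightarrow> 'e) \<Rightarrow> bool" where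
  "local_jet c F U f Df D2f \<longleftrightarrow> C2_jet U f Df D2f \<and>
    (\<forall>z \<in> U \<inter> half_space. f z = F (chart_inv c z) \<and> Df z = chart_deriv c F (chart_inv c z) \<and>
      D2f z = chart_deriv2 c F (chart_inv c z))"

lemma local_jet_subset:
  "local_jet c F U f Df D2f \<Longrightarrow> open V \<Longrightarrow> V \<subseteq> U \<Longrightarrow> local_jet c F V f Df D2f"
  unfolding local_jet_def using C2_jet_subset by blast

lemma local_jet_exists:
  fixes F :: "'m::topological_space \<Rightarrow> 'e::euclidean_space" and c :: "('m, 'd::euclidean_space) chart"
  assumes c: "is_chart M c" and F: "smooth_on (chart_image c) (in_chart c F)" and p: "p \<in> fst c"
  shows "\<exists>U f Df D2f. local_jet c F U f Df D2f \<and> snd c p \<in> U \<and> U \<inter> half_space \<subseteq> chart_image c"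
proof -
  have pi: "snd c p \<in> chart_image c" using p by (simp add: chart_image_def)
  obtain T where T: "open T" "chart_image c = half_space \<inter> T"
    using c unfolding is_chart_def openin_open by blast
  obtain U0 f where U0: "open U0" "snd c p \<in> U0" "Ck_on 2 U0 f"
    and f0: "\<And>y. y \<in> chart_image c \<inter> U0 \<Longrightarrow> f y = in_chart c F y"
    using F pi unfolding smooth_on_def by meson
  \<comment> \<open>\<open>T\<close> cuts the chart image out of the half-space; without it,
    \<open>U\<close> could meet the half-space outside the chart image.\<close>
  define U where "U = U0 \<inter> T"
  have U: "open U" "snd c p \<in> U" "U \<inter> half_space \<subseteq> chart_image c"
    using U0 T pi by (auto simp: U_def)
  have f: "f y = F (chart_inv c y)" if "y \<in> U \<inter> half_space" for y
    using f0[of y] that T by (auto simp: U_def in_chart_def)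
  define Df where "Df z = frechet_derivative f (at z)" for z
  define D2f where "D2f z u v = frechet_derivative (\<lambda>y. Df y v) (at z) u" for z u v
  have Ck: "Ck_on 2 U f" using U0(3) by (rule Ck_on_subset) (simp add: U_def)
  have jet: "C2_jet U f Df D2f"
    using Ck_on_imp_C2_jet[OF U(1) Ck] unfolding Df_def D2f_def .
  have D: "chart_deriv c F (chart_inv c z) = Df z" if "z \<in> U \<inter> half_space" for z
    using chart_deriv_eq[OF c U(1,3) that f C2_jetD(2)[OF jet]] that by blast
  \<comment> \<open>\<open>chart_deriv_eq\<close> again, now for the field of first chart
    derivatives, extended by \<open>Df\<close> in the fixed direction \<open>v\<close>.\<close>
  have D2: "chart_deriv2 c F (chart_inv c z) u v = D2f z u v" if z: "z \<in> U \<inter> half_space" for z u v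
  proof -
    have "chart_deriv c (\<lambda>q. chart_deriv c F q v) (chart_inv c z) = (\<lambda>u. D2f z u v)"
      by (rule chart_deriv_eq[OF c U(1,3) z, where G="\<lambda>y. Df y v"]) (use D C2_jetD(3)[OF jet] z in auto)
    then show ?thesis by (simp add: chart_deriv2_def)
  qed
  have "local_jet c F U f Df D2f"
    unfolding local_jet_def using jet f D D2 by (auto simp: fun_eq_iff)
  then show ?thesis using U by blast
qed

lemma continuous_on_openin_cover:
  fixes F :: "'a::t2_space \<Rightarrow> 'b::topological_space"
  assumes "\<And>p. p \<in> M \<Longrightarrow> \<exists>W. openin (top_of_set M) W \<and> p \<in> W \<and> continuous_on W F"
  shows "continuous_on M F"
  unfolding continuous_on_eq_continuous_within
proof
  fix p assume p: "p \<in> M"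
  obtain W where W: "openin (top_of_set M) W" "p \<in> W" "continuous_on W F" using assms[OF p] by blast
  then obtain T where T: "open T" "W = M \<inter> T" by (auto simp: openin_open)
  have "at p within W = at p within M"
    using W(2) T by (intro at_within_nhd[of p T]) auto
  then show "continuous (at p within M) F"
    using W(2,3) by (metis continuous_on_eq_continuous_within)
qed

section \<open>Pinched free boundary minimal hypersurfaces\<close>

locale pinched_hypersurface =
  fixes M :: "'m::t2_space set" and \<A> :: "('m, 'd::euclidean_space) chart set"
    and F N :: "'m \<Rightarrow> 'e::euclidean_space"
  assumes hyper: "oriented_immersed_hypersurface M \<A> F N"
    and free_bd: "free_boundary_in_unit_ball M \<A> F N"
    and minimal: "minimal \<A> F N"
    and pinched: "\<forall>c\<in>\<A>. \<forall>p\<in>fst c. norm_A_squared c F N p \<le> 2 * real DIM('d)"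
begin

section \<open>Covering the hypersurface by patches\<close>

lemma manifold: "M \<noteq> {}" "compact M" "connected M" "M = (\<Union>c\<in>\<A>. fst c)"
  and charts: "c \<in> \<A> \<Longrightarrow> is_chart M c"
  using hyper by (auto simp: oriented_immersed_hypersurface_def compact_connected_manifold_def smooth_atlas_def)

lemma chart_homeomorphism: "c \<in> \<A> \<Longrightarrow> homeomorphism (fst c) (chart_image c) (snd c) (chart_inv c)"
  using charts by (auto simp: is_chart_def)

lemma chart_image_subset: "c \<in> \<A> \<Longrightarrow> chart_image c \<subseteq> half_space"
  using charts openin_imp_subset unfolding is_chart_def by blast

lemma openin_chart_preimage:
  assumes c: "c \<in> \<A>" and V: "open V"
  shows "openin (top_of_set M) {q \<in> fst c. snd c q \<in> V}"
proof -
  have "openin (top_of_set (fst c)) (fst c \<inter> snd c -` V)"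
    using homeomorphism_cont1[OF chart_homeomorphism[OF c]] V by (rule continuous_openin_preimage_gen)
  moreover have "openin (top_of_set M) (fst c)" using charts[OF c] by (simp add: is_chart_def)
  ultimately have "openin (top_of_set M) (fst c \<inter> snd c -` V)" by (rule openin_trans)
  then show ?thesis by (simp add: vimage_def Int_def)
qed

definition patch where
  "patch c U f g Df Dg D2f D2g \<longleftrightarrow> c \<in> \<A> \<and> minimal_patch U f g Df Dg D2f D2g \<and>
    U \<inter> half_space \<subseteq> chart_image c \<and> local_jet c F U f Df D2f \<and> local_jet c N U g Dg D2g"

lemma patch_exists:
  assumes c: "c \<in> \<A>" and p: "p \<in> fst c"
  shows "\<exists>U f g Df Dg D2f D2g. patch c U f g Df Dg D2f D2g \<and> snd c p \<in> U"
proof -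
  have sm: "smooth_on (chart_image c) (in_chart c F)" "smooth_on (chart_image c) (in_chart c N)"
    using hyper c by (auto simp: oriented_immersed_hypersurface_def immersion_def unit_normal_field_def smooth_map_def)
  obtain U1 f Df D2f where 1: "local_jet c F U1 f Df D2f" "snd c p \<in> U1" "U1 \<inter> half_space \<subseteq> chart_image c"
    using local_jet_exists[OF charts[OF c] sm(1) p] by blast
  obtain U2 g Dg D2g where 2: "local_jet c N U2 g Dg D2g" "snd c p \<in> U2" "U2 \<inter> half_space \<subseteq> chart_image c"
    using local_jet_exists[OF charts[OF c] sm(2) p] by blast
  define U where "U = U1 \<inter> U2"
  have "open U1" "open U2" using 1 2 C2_jetD(1) unfolding local_jet_def by blast+
  then have "open U" by (auto simp: U_def)
  then have f: "local_jet c F U f Df D2f" and g: "local_jet c N U g Dg D2g"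
    using 1 2 by (auto intro: local_jet_subset simp: U_def)
  have U: "U \<inter> half_space \<subseteq> chart_image c" using 1 by (auto simp: U_def)
  have inv: "chart_inv c z \<in> fst c" if "z \<in> U \<inter> half_space" for z
    using homeomorphism_image2[OF chart_homeomorphism[OF c]] U that by blast
  have fz: "f z = F (chart_inv c z)" "Df z = chart_deriv c F (chart_inv c z)" "D2f z = chart_deriv2 c F (chart_inv c z)"
    and gz: "g z = N (chart_inv c z)" if "z \<in> U \<inter> half_space" for z
    using f g that by (auto simp: local_jet_def)
  have nf: "norm (N q) = 1" "N q \<bullet> chart_deriv c F q v = 0" and inj: "inj (chart_deriv c F q)" if "q \<in> fst c" for q v
    using hyper c that by (auto simp: oriented_immersed_hypersurface_def immersion_def unit_normal_field_def)
  interpret hypersurface_patch U f g Df Dg D2f D2g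
  proof
    show "DIM('e) = DIM('d) + 1" using hyper by (simp add: oriented_immersed_hypersurface_def)
    show "C2_jet U f Df D2f" "C2_jet U g Dg D2g" using f g by (auto simp: local_jet_def)
    fix z assume z: "z \<in> U \<inter> half_space"
    show "inj (Df z)" using inj[OF inv[OF z]] by (simp add: fz[OF z])
    show "g z \<bullet> g z = 1" using nf(1)[OF inv[OF z]] by (simp add: gz[OF z] dot_square_norm)
    show "Df z v \<bullet> g z = 0" for v using nf(2)[OF inv[OF z]] by (simp add: gz[OF z] fz[OF z] inner_commute)
  qed
  have "minimal_patch U f g Df Dg D2f D2g"
  proof
    fix z assume z: "z \<in> U \<inter> half_space"
    define q where "q = chart_inv c z"
    define B where "B = orthonormal_frame c F q"
    have frame_iff: "is_orthonormal_frame c F q C \<longleftrightarrow> frame (Df z) C" for C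
      by (simp add: is_orthonormal_frame_def frame_def first_fundamental_form_def fz[OF z] q_def)
    have "linear (Df z)" "inj (Df z)" using f_linear(1) inj z by auto
    \<comment> \<open>\<open>orthonormal_frame\<close> is a choice, so it has the properties of a
      frame only once one is known to exist.\<close>
    from frame_exists[OF this] have "frame (Df z) B"
      unfolding B_def orthonormal_frame_def frame_iff by (rule someI_ex)
    moreover have "mean_curvature c F N q = 0" "norm_A_squared c F N q \<le> 2 * real DIM('d)"
      using minimal pinched c inv[OF z] by (auto simp: minimal_def q_def)
    ultimately show "\<exists>B. frame (Df z) B \<and> (\<Sum>b\<in>B. D2f z b b \<bullet> g z) = 0 \<and>
        (\<Sum>b\<in>B. \<Sum>c\<in>B. (D2f z b c \<bullet> g z)\<^sup>2) \<le> 2 * real DIM('d)"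
      by (intro exI[of _ B])
        (simp add: mean_curvature_def norm_A_squared_def second_fundamental_form_def fz[OF z] gz[OF z] q_def B_def)
  qed
  then have "patch c U f g Df Dg D2f D2g" unfolding patch_def using c U f g by blast
  moreover have "snd c p \<in> U" using 1 2 by (simp add: U_def)
  ultimately show ?thesis by blast
qed

lemma patchD:
  assumes P: "patch c U f g Df Dg D2f D2g" and z: "z \<in> U \<inter> half_space"
  shows "chart_inv c z \<in> M" "chart_inv c z \<in> fst c" "snd c (chart_inv c z) = z"
    and "f z = F (chart_inv c z)" "g z = N (chart_inv c z)"
    and "f z \<bullet> f z \<le> 1"
    and "z \<bullet> inward_dir = 0 \<Longrightarrow> f z \<bullet> f z = 1" "z \<bullet> inward_dir = 0 \<Longrightarrow> f z \<bullet> g z = 0"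
proof -
  have c: "c \<in> \<A>" and zi: "z \<in> chart_image c" using P z by (auto simp: patch_def)
  show inv: "chart_inv c z \<in> fst c" using homeomorphism_image2[OF chart_homeomorphism[OF c]] zi by blast
  then show M: "chart_inv c z \<in> M" using manifold(4) c by blast
  show snd: "snd c (chart_inv c z) = z" using homeomorphism_apply2[OF chart_homeomorphism[OF c] zi] .
  show f: "f z = F (chart_inv c z)" and g: "g z = N (chart_inv c z)"
    using P z by (auto simp: patch_def local_jet_def)
  have "F (chart_inv c z) \<in> cball 0 1" using free_bd M by (auto simp: free_boundary_in_unit_ball_def)
  then show "f z \<bullet> f z \<le> 1" by (simp add: f dot_square_norm power_le_one)
  assume "z \<bullet> inward_dir = 0"
  then have "chart_inv c z \<in> manifold_boundary \<A>"
    using c inv snd by (auto simp: manifold_boundary_def)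
  then have "F (chart_inv c z) \<in> sphere 0 1" "orthogonal (N (chart_inv c z)) (F (chart_inv c z))"
    using free_bd by (auto simp: free_boundary_in_unit_ball_def)
  then show "f z \<bullet> f z = 1" "f z \<bullet> g z = 0"
    by (auto simp: f g dot_square_norm orthogonal_def inner_commute)
qed

lemma patch_at:
  assumes p: "p \<in> M"
  obtains c U f g Df Dg D2f D2g where "patch c U f g Df Dg D2f D2g" "p \<in> fst c"
    "snd c p \<in> U \<inter> half_space" "chart_inv c (snd c p) = p"
proof -
  obtain c where c: "c \<in> \<A>" "p \<in> fst c" using p manifold(4) by blast
  obtain U f g Df Dg D2f D2g where P: "patch c U f g Df Dg D2f D2g" "snd c p \<in> U"
    using patch_exists[OF c] by blast
  have "snd c p \<in> half_space"
    using chart_image_subset[OF c(1)] c(2) by (auto simp: chart_image_def)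
  moreover have "chart_inv c (snd c p) = p"
    using homeomorphism_apply1[OF chart_homeomorphism[OF c(1)] c(2)] .
  ultimately show ?thesis using that[OF P(1) c(2)] P(2) by blast
qed

lemma patch_point:
  assumes P: "patch c U f g Df Dg D2f D2g" and q: "q \<in> fst c" "snd c q \<in> U"
  shows "snd c q \<in> U \<inter> half_space" "chart_inv c (snd c q) = q" "F q = f (snd c q)" "N q = g (snd c q)"
proof -
  have c: "c \<in> \<A>" using P by (simp add: patch_def)
  show z: "snd c q \<in> U \<inter> half_space"
    using chart_image_subset[OF c] q by (auto simp: chart_image_def)
  show inv: "chart_inv c (snd c q) = q"
    using homeomorphism_apply1[OF chart_homeomorphism[OF c] q(1)] .
  show "F q = f (snd c q)" "N q = g (snd c q)" using patchD(4,5)[OF P z] inv by auto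
qed

lemma patch_minimal: "patch c U f g Df Dg D2f D2g \<Longrightarrow> minimal_patch U f g Df Dg D2f D2g"
  by (simp add: patch_def)

lemma patch_hypersurface: "patch c U f g Df Dg D2f D2g \<Longrightarrow> hypersurface_patch U f g Df Dg D2f D2g"
  using patch_minimal minimal_patch.axioms(1) by blast

lemma continuous_F: "continuous_on M F" and continuous_N: "continuous_on M N"
proof -
  have "\<exists>W. openin (top_of_set M) W \<and> p \<in> W \<and> continuous_on W F \<and> continuous_on W N" if p: "p \<in> M" for p
  proof -
    obtain c U f g Df Dg D2f D2g where P: "patch c U f g Df Dg D2f D2g" "p \<in> fst c" "snd c p \<in> U \<inter> half_space"
      using patch_at[OF p] by metis
    interpret hypersurface_patch U f g Df Dg D2f D2g using patch_hypersurface[OF P(1)] .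
    have c: "c \<in> \<A>" using P by (simp add: patch_def)
    define W where "W = {q \<in> fst c. snd c q \<in> U}"
    have snd: "continuous_on W (snd c)" "snd c ` W \<subseteq> U"
      using homeomorphism_cont1[OF chart_homeomorphism[OF c]] by (auto simp: W_def elim: continuous_on_subset)
    have "continuous_on U f" "continuous_on U g"
      using df dg by (meson continuous_at_imp_continuous_on has_derivative_continuous)+
    then have "continuous_on W (\<lambda>q. f (snd c q))" "continuous_on W (\<lambda>q. g (snd c q))"
      using snd by (auto intro: continuous_on_compose2)
    then have "continuous_on W F" "continuous_on W N"
      using patch_point(3,4)[OF P(1)] by (auto simp: W_def cong: continuous_on_cong_simp)
    then show ?thesis
      using openin_chart_preimage[OF c open_U] P by (intro exI[of _ W]) (auto simp: W_def)
  qed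
  then show "continuous_on M F" "continuous_on M N"
    by (meson continuous_on_openin_cover)+
qed

section \<open>Vanishing of the support function\<close>

lemma norm_F: "p \<in> M \<Longrightarrow> F p \<bullet> F p \<le> 1"
  using free_bd by (auto simp: free_boundary_in_unit_ball_def dot_square_norm power_le_one image_subset_iff)

text \<open>Stated with a factor \<sigma> so that the values 1 and -1 treat maximum and minimum at
  once. At a positive maximum of the quotient \<open>w\<close>, the barrier scaled by
  \<open>w q\<close> touches \<sigma> F . N from above.\<close>

lemma support_function_nonpos:
  assumes p: "p \<in> M"
  shows "\<sigma> * (F p \<bullet> N p) \<le> 0"
proof -
  define \<phi> where "\<phi> s = 13 - 14 * s + 2 * (s * s)" for s :: real
  have \<phi>_pos: "0 < \<phi> s" if "s \<le> 1" for s
  proof -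
    have "0 \<le> 2 * ((1 - s) * (1 - s))" by simp
    then show ?thesis using that unfolding \<phi>_def by (simp add: algebra_simps)
  qed
  define w where "w q = \<sigma> * (F q \<bullet> N q) / \<phi> (F q \<bullet> F q)" for q
  have "continuous_on M w"
    unfolding w_def \<phi>_def
    by (intro continuous_intros continuous_F continuous_N) (use \<phi>_pos norm_F in \<open>fastforce simp: \<phi>_def\<close>)
  then obtain q where q: "q \<in> M" "\<And>x. x \<in> M \<Longrightarrow> w x \<le> w q"
    using continuous_attains_sup manifold(1,2) by metis
  have "w q \<le> 0"
  proof (rule ccontr)
    assume "\<not> w q \<le> 0"
    then have pos: "0 < w q" by simp
    obtain c U f g Df Dg D2f D2g where P: "patch c U f g Df Dg D2f D2g" and z: "snd c q \<in> U \<inter> half_space"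
      and inv: "chart_inv c (snd c q) = q"
      using patch_at[OF q(1)] by metis
    interpret minimal_patch U f g Df Dg D2f D2g using patch_minimal[OF P] .
    have qf: "f (snd c q) = F q" "g (snd c q) = N q" using patchD(4,5)[OF P z] inv by auto
    have le: "\<sigma> * (F x \<bullet> N x) \<le> w q * \<phi> (F x \<bullet> F x)" if "x \<in> M" for x
      using q(2)[OF that] \<phi>_pos[OF norm_F[OF that]] by (simp add: w_def[of x] pos_divide_le_eq)
    have eq: "\<sigma> * (F q \<bullet> N q) = w q * \<phi> (F q \<bullet> F q)"
      using \<phi>_pos[OF norm_F[OF q(1)]] by (simp add: w_def)
    \<comment> \<open>The free boundary condition makes the support function vanish on the boundary,
      so the touching point is interior.\<close>
    have "F q \<bullet> N q \<noteq> 0" using pos by (auto simp: w_def)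
    then have "snd c q \<bullet> inward_dir \<noteq> 0" using patchD(8)[OF P z] qf by auto
    then have int: "0 < snd c q \<bullet> inward_dir" using z by (simp add: half_space_def)
    show False
    proof (rule support_function_no_touching[OF _ int _ pos, of \<sigma>])
      show "snd c q \<in> U" using z by simp
      show "f (snd c q) \<bullet> f (snd c q) \<le> 1" using patchD(6)[OF P z] .
      show "\<sigma> * (f y \<bullet> g y) \<le> w q * (13 - 14 * (f y \<bullet> f y) + 2 * (f y \<bullet> f y * (f y \<bullet> f y)))"
        if "y \<in> U \<inter> half_space" for y
        using le[OF patchD(1)[OF P that]] patchD(4,5)[OF P that] by (simp add: \<phi>_def)
      show "\<sigma> * (f (snd c q) \<bullet> g (snd c q)) = w q * (13 - 14 * (f (snd c q) \<bullet> f (snd c q)) +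
          2 * (f (snd c q) \<bullet> f (snd c q) * (f (snd c q) \<bullet> f (snd c q))))"
        using eq by (simp add: qf \<phi>_def)
    qed
  qed
  then have "w p \<le> 0" using q(2)[OF p] by linarith
  then show ?thesis using \<phi>_pos[OF norm_F[OF p]] by (simp add: w_def divide_le_0_iff)
qed

lemma support_function_zero: "p \<in> M \<Longrightarrow> F p \<bullet> N p = 0"
  using support_function_nonpos[of p 1] support_function_nonpos[of p "- 1"] by simp

section \<open>The cone and its constant normal\<close>

lemma locally_injective_F:
  assumes p: "p \<in> M"
  shows "\<exists>W. openin (top_of_set M) W \<and> p \<in> W \<and> inj_on F W"
proof -
  obtain c U f g Df Dg D2f D2g where P: "patch c U f g Df Dg D2f D2g" "p \<in> fst c" "snd c p \<in> U \<inter> half_space"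
    using patch_at[OF p] by metis
  interpret hypersurface_patch U f g Df Dg D2f D2g using patch_hypersurface[OF P(1)] .
  have c: "c \<in> \<A>" using P by (simp add: patch_def)
  obtain r where r: "0 < r" "ball (snd c p) r \<subseteq> U" "inj_on f (ball (snd c p) r)"
    using locally_injective[OF P(3)] by blast
  define W where "W = {q \<in> fst c. snd c q \<in> ball (snd c p) r}"
  have "inj_on F W"
  proof (rule inj_onI)
    fix x y assume xy: "x \<in> W" "y \<in> W" "F x = F y"
    then have U: "x \<in> fst c" "snd c x \<in> U" "y \<in> fst c" "snd c y \<in> U" using r by (auto simp: W_def)
    then have "f (snd c x) = f (snd c y)"
      using patch_point(3)[OF P(1)] xy by metis
    then have "snd c x = snd c y" using r(3) xy by (auto simp: W_def inj_on_def)
    then show "x = y" using patch_point(2)[OF P(1)] U by metis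
  qed
  then show ?thesis
    using openin_chart_preimage[OF c open_ball] P r by (intro exI[of _ W]) (auto simp: W_def)
qed

text \<open>Finitely many sets on which \<open>F\<close> is injective cover \<open>M\<close>, and
  each contains at most one zero.\<close>

lemma finite_zeros: "finite {p \<in> M. F p = 0}"
proof -
  obtain W where W: "\<And>p. p \<in> M \<Longrightarrow> openin (top_of_set M) (W p)" "\<And>p. p \<in> M \<Longrightarrow> p \<in> W p"
    "\<And>p. p \<in> M \<Longrightarrow> inj_on F (W p)"
    using locally_injective_F by metis
  obtain T where T: "\<And>p. p \<in> M \<Longrightarrow> open (T p)" "\<And>p. p \<in> M \<Longrightarrow> W p = M \<inter> T p"
    using W(1) unfolding openin_open by metis
  have "M \<subseteq> (\<Union>p\<in>M. T p)" using W(2) T(2) by blast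
  from compactE_image[OF manifold(2) _ this] T(1) obtain C where
    C: "C \<subseteq> M" "finite C" "M \<subseteq> (\<Union>p\<in>C. T p)" by metis
  have "finite {q \<in> W p. F q = 0}" if "p \<in> C" for p
  proof -
    have "inj_on F {q \<in> W p. F q = 0}"
      using W(3)[of p] C(1) that by (auto simp: inj_on_def)
    moreover have "finite (F ` {q \<in> W p. F q = 0})"
      by (rule finite_subset[of _ "{0}"]) auto
    ultimately show ?thesis using finite_imageD by blast
  qed
  then have "finite (\<Union>p\<in>C. {q \<in> W p. F q = 0})" using C(2) by blast
  moreover have "{p \<in> M. F p = 0} \<subseteq> (\<Union>p\<in>C. {q \<in> W p. F q = 0})"
    using C T(2) by blast
  ultimately show ?thesis by (rule finite_subset[rotated])
qed

text \<open>The normal is constant along the rays of the cone. Instead of following the rays, minimise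
  \<open>\<psi>(N) + \<epsilon> |F|\<^sup>2\<close>: moving towards the origin decreases it, so the minimum is at a zero of
  \<open>F\<close>. With \<open>\<psi>\<close> vanishing exactly at the finitely many values of \<open>N\<close> there, \<open>N\<close> takes no other value.\<close>

lemma normal_constant: "\<exists>a. norm a = 1 \<and> (\<forall>p\<in>M. N p = a)"
proof -
  define Z where "Z = N ` {p \<in> M. F p = 0}"
  have Z: "finite Z" using finite_zeros by (simp add: Z_def)
  \<comment> \<open>A smooth function that is nonpositive and zero exactly on \<open>Z\<close>; for
    empty \<open>Z\<close> it is the constant -1.\<close>
  define \<psi> where "\<psi> y = - (\<Prod>a\<in>Z. (y - a) \<bullet> (y - a))" for y
  have "\<exists>D. ((\<lambda>y. \<Prod>a\<in>S. (y - a) \<bullet> (y - a)) has_derivative D) (at x)" if "finite S" for S and x :: 'e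
    using that
  proof (induction S)
    case empty
    then show ?case by (auto intro!: exI has_derivative_const)
  next
    case (insert a S)
    then obtain D where D: "((\<lambda>y. \<Prod>a\<in>S. (y - a) \<bullet> (y - a)) has_derivative D) (at x)" by blast
    have "((\<lambda>y. (y - a) \<bullet> (y - a)) has_derivative (\<lambda>v. (x - a) \<bullet> v + v \<bullet> (x - a))) (at x)"
      by (auto intro!: derivative_eq_intros)
    from has_derivative_mult[OF this D] insert.hyps show ?case by auto
  qed
  then have \<psi>_diff: "\<psi> differentiable (at x)" for x
    unfolding \<psi>_def using Z differentiableI differentiable_minus by blast
  then have \<psi>_cont: "continuous_on UNIV \<psi>"
    by (meson continuous_at_imp_continuous_on differentiable_imp_continuous_within)
  have \<psi>_nonpos: "\<psi> y \<le> 0" for y unfolding \<psi>_def by (simp add: prod_nonneg)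
  have "N q \<in> Z" if q: "q \<in> M" for q
  proof (rule ccontr)
    assume "N q \<notin> Z"
    then have "\<psi> (N q) \<noteq> 0" using Z by (auto simp: \<psi>_def)
    then have neg: "\<psi> (N q) < 0" using \<psi>_nonpos[of "N q"] by linarith
    \<comment> \<open>As |F|^2 <= 1, the perturbation raises the value at \<open>q\<close> by at
      most half of its depth, so \<open>w q\<close> stays negative, whereas \<open>w\<close> is 0 at
      the minimum found below.\<close>
    define \<epsilon> where "\<epsilon> = - \<psi> (N q) / 2"
    have \<epsilon>: "0 < \<epsilon>" using neg by (simp add: \<epsilon>_def)
    define w where "w x = \<psi> (N x) + \<epsilon> * (F x \<bullet> F x)" for x
    have "continuous_on M w"
      unfolding w_def using continuous_on_compose2[OF \<psi>_cont continuous_N]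
      by (intro continuous_intros continuous_F) auto
    then obtain p where p: "p \<in> M" "\<And>x. x \<in> M \<Longrightarrow> w p \<le> w x"
      using continuous_attains_inf manifold(1,2) by metis
    obtain c U f g Df Dg D2f D2g where P: "patch c U f g Df Dg D2f D2g" and z: "snd c p \<in> U \<inter> half_space"
      and inv: "chart_inv c (snd c p) = p"
      using patch_at[OF p(1)] by metis
    interpret hypersurface_patch U f g Df Dg D2f D2g using patch_hypersurface[OF P] .
    have pf: "f (snd c p) = F p" "g (snd c p) = N p" using patchD(4,5)[OF P z] inv by auto
    have "f (snd c p) = 0"
    proof (rule conical_min_at_origin[OF z _ patchD(6)[OF P] patchD(7)[OF P z] \<psi>_diff \<epsilon>])
      show "f y \<bullet> g y = 0" if "y \<in> U \<inter> half_space" for y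
        using support_function_zero[OF patchD(1)[OF P that]] patchD(4,5)[OF P that] by simp
      show "\<psi> (g (snd c p)) + \<epsilon> * (f (snd c p) \<bullet> f (snd c p)) \<le> \<psi> (g y) + \<epsilon> * (f y \<bullet> f y)"
        if "y \<in> U \<inter> half_space" for y
        using p(2)[OF patchD(1)[OF P that]] patchD(4,5)[OF P that] by (simp add: pf w_def)
    qed
    then have "F p = 0" using pf by simp
    then have "N p \<in> Z" using p by (auto simp: Z_def)
    then have "\<psi> (N p) = 0" using Z by (auto simp: \<psi>_def)
    then have "0 \<le> w q" using p(2)[OF q] \<open>F p = 0\<close> by (simp add: w_def)
    moreover have "\<epsilon> * (F q \<bullet> F q) \<le> \<epsilon>" using norm_F[OF q] \<epsilon> by (simp add: mult_left_le)
    ultimately show False using neg by (simp add: w_def \<epsilon>_def)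
  qed
  then have "finite (N ` M)" using Z by (meson finite_subset image_subsetI)
  moreover have "connected (N ` M)"
    using continuous_N manifold(3) by (rule connected_continuous_image)
  ultimately obtain a where a: "N ` M = {a}"
    using manifold(1) connected_finite_iff_sing by blast
  obtain p where p: "p \<in> M" using manifold(1) by blast
  obtain c where "c \<in> \<A>" "p \<in> fst c" using p manifold(4) by blast
  then have "norm (N p) = 1"
    using hyper by (auto simp: oriented_immersed_hypersurface_def unit_normal_field_def)
  moreover have "N q = a" if "q \<in> M" for q using a that by blast
  ultimately show ?thesis using p by (intro exI[of _ a]) auto
qed

section \<open>From a constant normal to the equatorial disk\<close>

lemma totally_geodesic: "totally_geodesic \<A> F N"
  unfolding totally_geodesic_def
proof (intro ballI allI)
  fix c p u v assume c: "c \<in> \<A>" and p: "p \<in> fst c"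
  obtain a where a: "\<And>p. p \<in> M \<Longrightarrow> N p = a" using normal_constant by blast
  obtain U f g Df Dg D2f D2g where P: "patch c U f g Df Dg D2f D2g" "snd c p \<in> U"
    using patch_exists[OF c p] by blast
  interpret hypersurface_patch U f g Df Dg D2f D2g using patch_hypersurface[OF P(1)] .
  have z: "snd c p \<in> U \<inter> half_space" and inv: "chart_inv c (snd c p) = p"
    using patch_point[OF P(1) p P(2)] by auto
  have g: "g y = a" if "y \<in> U \<inter> half_space" for y
    using patchD(1,5)[OF P(1) that] a by simp
  have "Dg (snd c p) u = 0"
    by (rule half_space_deriv_zero[OF dg open_U]) (use z g in auto)
  moreover have "second_fundamental_form c F N p u v = D2f (snd c p) u v \<bullet> g (snd c p)"
    using P(1) z inv by (auto simp: second_fundamental_form_def patch_def local_jet_def)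
  ultimately show "second_fundamental_form c F N p u v = 0"
    using weingarten[OF z, of u v] by simp
qed

text \<open>Interior and boundary points are treated alike. To reach a point \<zeta> of the disk
  near \<open>F p\<close>, minimise the distance to \<zeta> over a compact piece \<open>C\<close> of
  the chart; the minimum avoids the spherical part of its boundary, so
  \<open>planar_min_distance\<close> applies. The inverse is continuous because \<open>C\<close> is
  compact.\<close>

lemma local_homeomorphism:
  assumes a: "\<And>p. p \<in> M \<Longrightarrow> N p = a" and p: "p \<in> M"
  shows "\<exists>W r h. openin (top_of_set M) W \<and> p \<in> W \<and> 0 < r \<and>
    homeomorphism W ((cball 0 1 \<inter> {x. a \<bullet> x = 0}) \<inter> ball (F p) r) F h"
proof -
  define D where "D = cball 0 1 \<inter> {x. a \<bullet> x = 0}"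
  have FD: "F q \<in> D" if "q \<in> M" for q
    using free_bd support_function_zero[OF that] a[OF that] that
    by (auto simp: D_def free_boundary_in_unit_ball_def inner_commute image_subset_iff)
  obtain c U f g Df Dg D2f D2g where P: "patch c U f g Df Dg D2f D2g" "p \<in> fst c" "snd c p \<in> U \<inter> half_space"
    and inv: "chart_inv c (snd c p) = p"
    using patch_at[OF p] by metis
  interpret hypersurface_patch U f g Df Dg D2f D2g using patch_hypersurface[OF P(1)] .
  have c: "c \<in> \<A>" and Uc: "U \<inter> half_space \<subseteq> chart_image c" using P by (auto simp: patch_def)
  define z0 where "z0 = snd c p"
  have fz0: "f z0 = F p" using patch_point(3)[OF P(1,2)] P(3) by (simp add: z0_def)
  obtain r where r: "0 < r" "ball z0 r \<subseteq> U" "inj_on f (ball z0 r)"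
    using locally_injective[OF P(3)] unfolding z0_def by blast
  define \<rho> where "\<rho> = r / 2"
  have \<rho>: "0 < \<rho>" "cball z0 \<rho> \<subseteq> ball z0 r" "ball z0 \<rho> \<subseteq> U" using r by (auto simp: \<rho>_def)
  define C where "C = cball z0 \<rho> \<inter> half_space"
  have z0C: "z0 \<in> C" using P(3) \<rho> by (simp add: C_def z0_def)
  have CU: "C \<subseteq> U \<inter> half_space" using \<rho> r by (auto simp: C_def)
  have compC: "compact C" unfolding C_def using closed_half_space by (intro compact_Int_closed compact_cball)
  have contU: "continuous_on U f"
    using df by (meson continuous_at_imp_continuous_on has_derivative_continuous)
  then have contC: "continuous_on C f" using CU by (meson continuous_on_subset le_inf_iff)
  have injC: "inj_on f C" using r(3) by (rule inj_on_subset) (use \<rho> in \<open>auto simp: C_def\<close>)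
  \<comment> \<open>A lower bound for the distance from \<open>F p\<close> to the image of the
    spherical part; it is positive by injectivity on \<open>C\<close>.\<close>
  obtain m where m: "0 < m" "\<And>z. z \<in> sphere z0 \<rho> \<inter> half_space \<Longrightarrow> m \<le> dist (f z) (F p)"
  proof (cases "sphere z0 \<rho> \<inter> half_space = {}")
    case True
    then show ?thesis using that[of 1] by simp
  next
    case False
    define T where "T = sphere z0 \<rho> \<inter> half_space"
    have TC: "T \<subseteq> C" by (auto simp: T_def C_def)
    have "compact T" unfolding T_def using closed_half_space by (intro compact_Int_closed compact_sphere)
    moreover have "continuous_on T (\<lambda>z. dist (f z) (F p))"
      using continuous_on_subset[OF contC TC] by (intro continuous_intros)
    ultimately obtain t where t: "t \<in> T" "\<And>z. z \<in> T \<Longrightarrow> dist (f t) (F p) \<le> dist (f z) (F p)"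
      using continuous_attains_inf[of T "\<lambda>z. dist (f z) (F p)"] False unfolding T_def by metis
    have "t \<noteq> z0" using t(1) \<rho>(1) by (auto simp: T_def)
    then have "f t \<noteq> f z0" using injC TC t(1) z0C by (auto simp: inj_on_def)
    then show ?thesis using that[of "dist (f t) (F p)"] t(2) fz0 by (simp add: T_def)
  qed
  \<comment> \<open>With threshold m/2, the centre \<open>z0\<close> is already closer to \<zeta>
    than any point of the sphere can be.\<close>
  have onto_int: "\<zeta> \<in> f ` C" if \<zeta>: "\<zeta> \<in> D" "norm \<zeta> < 1" "dist (F p) \<zeta> < m / 2" for \<zeta>
  proof -
    have "continuous_on C (\<lambda>z. dist (f z) \<zeta>)" using contC by (intro continuous_intros)
    then obtain z where z: "z \<in> C" "\<And>y. y \<in> C \<Longrightarrow> dist (f z) \<zeta> \<le> dist (f y) \<zeta>"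
      using continuous_attains_inf[OF compC, of "\<lambda>z. dist (f z) \<zeta>"] z0C by (metis empty_iff)
    have near: "dist (f z) \<zeta> < m / 2" using z(2)[OF z0C] \<zeta>(3) fz0 by simp
    have "z \<notin> sphere z0 \<rho>"
    proof
      assume "z \<in> sphere z0 \<rho>"
      then have "m \<le> dist (f z) (F p)" using m(2) z(1) by (simp add: C_def)
      also have "\<dots> \<le> dist (f z) \<zeta> + dist (F p) \<zeta>"
        using dist_triangle2 by blast
      finally show False using near \<zeta>(3) by simp
    qed
    then have zb: "z \<in> ball z0 \<rho>" using z(1) by (auto simp: C_def)
    have zU: "z \<in> U \<inter> half_space" using CU z(1) by blast
    have "f z = \<zeta>"
    proof (rule planar_min_distance[OF zU patchD(6)[OF P(1)] patchD(7)[OF P(1) zU] _ _ \<zeta>(2) open_ball zb \<rho>(3)])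
      have "chart_inv c z \<in> M" using patchD(1)[OF P(1) zU] .
      then show "f z \<bullet> g z = 0" using support_function_zero patchD(4,5)[OF P(1) zU] by simp
      have "g z = a" using a patchD(1,5)[OF P(1) zU] by simp
      then show "\<zeta> \<bullet> g z = 0" using \<zeta>(1) by (simp add: D_def inner_commute)
      show "dist (f z) \<zeta> \<le> dist (f y) \<zeta>" if "y \<in> ball z0 \<rho> \<inter> half_space" for y
        using z(2)[of y] that by (simp add: C_def)
    qed
    then show ?thesis using z(1) by blast
  qed
  \<comment> \<open>Points of norm 1 are limits of t \<zeta> with t < 1, and the compact image of
    \<open>C\<close> is closed.\<close>
  have onto: "\<zeta> \<in> f ` C" if \<zeta>: "\<zeta> \<in> D" "dist (F p) \<zeta> < m / 2" for \<zeta>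
  proof -
    have lim: "((\<lambda>t. t *\<^sub>R \<zeta>) \<longlongrightarrow> 1 *\<^sub>R \<zeta>) (at_left (1::real))" by (intro tendsto_intros)
    then have "((\<lambda>t. dist (F p) (t *\<^sub>R \<zeta>)) \<longlongrightarrow> dist (F p) (1 *\<^sub>R \<zeta>)) (at_left (1::real))"
      by (intro tendsto_intros)
    then have "eventually (\<lambda>t. dist (F p) (t *\<^sub>R \<zeta>) < m / 2) (at_left (1::real))"
      using \<zeta>(2) by (intro order_tendstoD(2)) auto
    moreover have "eventually (\<lambda>t. t \<in> {0<..<1}) (at_left (1::real))"
      by (rule eventually_at_left_real) simp
    ultimately have "eventually (\<lambda>t. t *\<^sub>R \<zeta> \<in> f ` C) (at_left (1::real))"
    proof eventually_elim
      case (elim t)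
      have n: "norm \<zeta> \<le> 1" using \<zeta>(1) by (simp add: D_def)
      have "norm (t *\<^sub>R \<zeta>) \<le> t" using mult_left_mono[OF n, of t] elim by simp
      then have "norm (t *\<^sub>R \<zeta>) < 1"
        using elim by (metis greaterThanLessThan_iff order_le_less_trans)
      moreover have "t *\<^sub>R \<zeta> \<in> D" using \<open>norm (t *\<^sub>R \<zeta>) < 1\<close> \<zeta>(1) by (simp add: D_def)
      ultimately show ?case using elim by (intro onto_int) auto
    qed
    moreover have "closed (f ` C)" using compact_continuous_image[OF contC compC] compact_imp_closed by blast
    ultimately show ?thesis using Lim_in_closed_set[OF _ _ _ lim] by simp
  qed
  obtain k where k: "homeomorphism C (f ` C) f k"
    using homeomorphism_compact[OF compC contC refl injC] by blast
  define W where "W = {q \<in> fst c. snd c q \<in> ball z0 \<rho>} \<inter> (M \<inter> F -` ball (F p) (m / 2))"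
  have "openin (top_of_set M) W"
    unfolding W_def using openin_chart_preimage[OF c open_ball] continuous_openin_preimage_gen[OF continuous_F open_ball]
    by (rule openin_Int)
  moreover have "p \<in> W" using P(2) p \<rho> m by (simp add: W_def z0_def)
  moreover have "homeomorphism W (D \<inter> ball (F p) (m / 2)) F (chart_inv c \<circ> k)"
  proof (rule homeomorphismI)
    have sub: "D \<inter> ball (F p) (m / 2) \<subseteq> f ` C" using onto by auto
    have kC: "k \<zeta> \<in> C" "f (k \<zeta>) = \<zeta>" if "\<zeta> \<in> D \<inter> ball (F p) (m / 2)" for \<zeta>
      using sub that homeomorphism_image2[OF k] homeomorphism_apply2[OF k] by blast+
    have WU: "snd c q \<in> U" "snd c q \<in> C" "q \<in> fst c" if "q \<in> W" for q
      using that \<rho>(3) chart_image_subset[OF c] by (auto simp: W_def C_def chart_image_def)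
    show "continuous_on W F"
      using continuous_F by (rule continuous_on_subset) (auto simp: W_def)
    have "continuous_on (D \<inter> ball (F p) (m / 2)) k"
      using homeomorphism_cont2[OF k] sub by (rule continuous_on_subset)
    moreover have "continuous_on (k ` (D \<inter> ball (F p) (m / 2))) (chart_inv c)"
      using homeomorphism_cont2[OF chart_homeomorphism[OF c]]
      by (rule continuous_on_subset) (use kC CU Uc in blast)
    ultimately show "continuous_on (D \<inter> ball (F p) (m / 2)) (chart_inv c \<circ> k)"
      by (rule continuous_on_compose)
    show "F ` W \<subseteq> D \<inter> ball (F p) (m / 2)" using FD by (auto simp: W_def)
    show FF: "F ((chart_inv c \<circ> k) \<zeta>) = \<zeta>" if "\<zeta> \<in> D \<inter> ball (F p) (m / 2)" for \<zeta>
    proof -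
      have "k \<zeta> \<in> U \<inter> half_space" using kC(1)[OF that] CU by blast
      then show ?thesis using patchD(4)[OF P(1)] kC(2)[OF that] by simp
    qed
    show "(chart_inv c \<circ> k) (F q) = q" if "q \<in> W" for q
      using patch_point(2,3)[OF P(1)] WU[OF that] homeomorphism_apply1[OF k] by simp
    show "(chart_inv c \<circ> k) ` (D \<inter> ball (F p) (m / 2)) \<subseteq> W"
    proof (rule image_subsetI)
      fix \<zeta> assume \<zeta>: "\<zeta> \<in> D \<inter> ball (F p) (m / 2)"
      have kU: "k \<zeta> \<in> U \<inter> half_space" using kC(1)[OF \<zeta>] CU by blast
      \<comment> \<open>\<open>k\<close> takes values in the closed piece \<open>C\<close>, while
        \<open>W\<close> is cut out by the open ball; the choice of \<open>m\<close> closes this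
        gap.\<close>
      have "k \<zeta> \<notin> sphere z0 \<rho>"
      proof
        assume "k \<zeta> \<in> sphere z0 \<rho>"
        then have "m \<le> dist \<zeta> (F p)" using m(2)[of "k \<zeta>"] kC[OF \<zeta>] by (simp add: C_def)
        then show False using \<zeta> m(1) by (simp add: dist_commute)
      qed
      then have "k \<zeta> \<in> ball z0 \<rho>" using kC(1)[OF \<zeta>] by (auto simp: C_def)
      then show "(chart_inv c \<circ> k) \<zeta> \<in> W"
        using patchD(1,2,3)[OF P(1) kU] FF[OF \<zeta>] \<zeta> by (simp add: W_def)
    qed
  qed
  ultimately show ?thesis using m(1) unfolding D_def by (intro exI[of _ W] exI[of _ "m / 2"]) auto
qed

lemma equatorial: "inj_on F M" "equatorial_disk (F ` M)"
proof -
  obtain a where a1: "norm a = 1" and a: "\<And>p. p \<in> M \<Longrightarrow> N p = a" using normal_constant by blast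
  define D where "D = cball 0 1 \<inter> {x. a \<bullet> x = 0}"
  have D: "convex D" unfolding D_def by (intro convex_Int convex_cball convex_hyperplane)
  have FD: "F ` M \<subseteq> D"
    using free_bd support_function_zero a
    by (auto simp: D_def free_boundary_in_unit_ball_def inner_commute image_subset_iff)
  have loc: "\<exists>W r h. openin (top_of_set M) W \<and> p \<in> W \<and> 0 < r \<and> homeomorphism W (D \<inter> ball (F p) r) F h"
    if "p \<in> M" for p
    unfolding D_def by (rule local_homeomorphism) (use a that in auto)
  show "inj_on F M"
    using local_homeomorphism_onto_convex_inj[OF manifold(2,3) continuous_F D FD loc] .
  \<comment> \<open>The image contains a relative ball of the disk around each of its points; being
    also compact, it fills the connected disk.\<close>
  have "openin (top_of_set D) (F ` M)"
  proof (subst openin_subopen, intro ballI)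
    fix y assume "y \<in> F ` M"
    then obtain p where p: "p \<in> M" "y = F p" by blast
    obtain W r h where W: "openin (top_of_set M) W" "0 < r" "homeomorphism W (D \<inter> ball (F p) r) F h"
      using loc[OF p(1)] by blast
    have "D \<inter> ball (F p) r = F ` W" using homeomorphism_image1[OF W(3)] by simp
    also have "\<dots> \<subseteq> F ` M" using openin_imp_subset[OF W(1)] by blast
    finally show "\<exists>T. openin (top_of_set D) T \<and> y \<in> T \<and> T \<subseteq> F ` M"
      using p FD W(2) by (intro exI[of _ "D \<inter> ball (F p) r"]) auto
  qed
  moreover have "closedin (top_of_set D) (F ` M)"
    using FD compact_continuous_image[OF continuous_F manifold(2)] by (simp add: closed_subset compact_imp_closed)
  ultimately have "F ` M = D"
    using convex_connected[OF D] manifold(1) unfolding connected_clopen by blast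
  moreover have "a \<noteq> 0" using a1 by auto
  ultimately show "equatorial_disk (F ` M)" unfolding equatorial_disk_def D_def by blast
qed

end

theorem theoremD:
  fixes n :: nat
    and M :: "'m::t2_space set"
    and \<A> :: "('m, 'd::euclidean_space) chart set"
    and F N :: "'m \<Rightarrow> 'e::euclidean_space"
  assumes "DIM('d) = n" and "DIM('e) = n + 1"
    and "oriented_immersed_hypersurface M \<A> F N"
    and "free_boundary_in_unit_ball M \<A> F N"
    and "minimal \<A> F N"
    and "\<forall>c\<in>\<A>. \<forall>p\<in>fst c. norm_A_squared c F N p \<le> 2 * real n"
  shows "totally_geodesic \<A> F N \<and> inj_on F M \<and> equatorial_disk (F ` M)"
proof -
  interpret pinched_hypersurface M \<A> F N
    using assms by unfold_locales auto
  show ?thesis using totally_geodesic equatorial by blast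
qed

end
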